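(* Fix $k\ge 3$ and let $\alpha=(k-2)/\left(\binom{k-1}{2}+1\right)$. Then \[ \hat{R}(\mathcal{P}_{n,k-1}^{(k)}) = O\!\left(n^{k-1-\alpha}(\log n)^{1+\alpha}\right). \]
   Context: The tight path $\mathcal{P}_{n,k-1}^{(k)}$ is the $k$-uniform hypergraph with vertex set $[n]$ whose edges are the $n-k+1$ sets $\{i,i+1,\dots,i+k-1\}$, $1\le i\le n-k+1$. For $k$-graphs, $\mathcal{H}\to\mathcal{G}$ means every 2-coloring of the edges of $\mathcal{H}$ yields a monochromatic copy of $\mathcal{G}$, and the size-Ramsey number is $\hat{R}(\mathcal{G})=\min\{|E(\mathcal{H})|:\mathcal{H}\to\mathcal{G}\}$. *)

theory Defs
  imports Complex_Main "HOL-Library.Landau_Symbols" "HOL-Library.Ramsey"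
begin

type_synonym 'a hypergraph = "'a set \<times> 'a set set"

abbreviation verts :: "'a hypergraph \<Rightarrow> 'a set" where
  "verts H \<equiv> fst H"

abbreviation hedges :: "'a hypergraph \<Rightarrow> 'a set set" where
  "hedges H \<equiv> snd H"

definition uniform_hypergraph :: "nat \<Rightarrow> 'a hypergraph \<Rightarrow> bool" where
  "uniform_hypergraph k H \<longleftrightarrow>
     finite (verts H) \<and> (\<forall>e\<in>hedges H. e \<subseteq> verts H \<and> card e = k)"

definition tight_path :: "nat \<Rightarrow> nat \<Rightarrow> nat hypergraph" where
  "tight_path k n = ({1..n}, {{i..i + k - 1} | i. 1 \<le> i \<and> i + k - 1 \<le> n})"

text \<open>A copy need not be induced.\<close>

definition copy_of_in :: "('b \<Rightarrow> 'a) \<Rightarrow> 'b hypergraph \<Rightarrow> 'a hypergraph \<Rightarrow> bool" where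
  "copy_of_in f G H \<longleftrightarrow>
     inj_on f (verts G) \<and> f ` verts G \<subseteq> verts H \<and> (\<forall>e\<in>hedges G. f ` e \<in> hedges H)"

definition ramsey_arrow :: "'a hypergraph \<Rightarrow> 'b hypergraph \<Rightarrow> bool" where
  "ramsey_arrow H G \<longleftrightarrow>
     (\<forall>c :: 'a set \<Rightarrow> bool. \<exists>f b. copy_of_in f G H \<and> (\<forall>e\<in>hedges G. c (f ` e) = b))"

text \<open>
  Every finite hypergraph is isomorphic to one on natural numbers, so letting the host range
  over those loses nothing (\<open>size_ramsey_le\<close>). The minimum is over a nonempty set by Ramsey's
  theorem (\<open>size_ramsey_attained\<close>), so the value \<open>Inf {} = 0\<close> does not occur.
\<close>

definition size_ramsey :: "nat \<Rightarrow> 'b hypergraph \<Rightarrow> nat" where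
  "size_ramsey k G =
     Inf {card (hedges H) | H :: nat hypergraph. uniform_hypergraph k H \<and> ramsey_arrow H G}"

lemma ramsey_arrow_exists:
  fixes G :: "'b hypergraph"
  assumes G: "uniform_hypergraph k G"
  shows "\<exists>H :: nat hypergraph. uniform_hypergraph k H \<and> ramsey_arrow H G"
proof -
  define m where "m = card (verts G)"
  have finG: "finite (verts G)" using G by (simp add: uniform_hypergraph_def)
  obtain N :: nat where N: "partn_lst {..<N} [m, m] k"
    using ramsey_full by blast
  define H :: "nat hypergraph" where "H = ({..<N}, nsets {..<N} k)"
  have "uniform_hypergraph k H"
    by (auto simp: uniform_hypergraph_def H_def nsets_def)
  moreover have "ramsey_arrow H G"
    unfolding ramsey_arrow_def
  proof
    fix c :: "nat set \<Rightarrow> bool"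
    define d :: "nat set \<Rightarrow> nat" where "d e = (if c e then 1 else 0)" for e
    have "d \<in> nsets {..<N} k \<rightarrow> {..<length [m, m]}" by (auto simp: d_def)
    with N obtain i S where i: "i < length [m, m]" "S \<in> nsets {..<N} ([m, m] ! i)"
      and mono: "d ` nsets S k \<subseteq> {i}"
      unfolding partn_lst_def monochromatic_def by blast
    have S: "S \<subseteq> {..<N}" "finite S" "card S = m"
      using i by (auto simp: nsets_def less_Suc_eq)
    obtain f where f: "bij_betw f (verts G) S"
      using finite_same_card_bij[OF finG S(2)] S(3) m_def by auto
    have img: "f ` e \<in> nsets S k" if "e \<in> hedges G" for e
    proof -
      from that G have e: "e \<subseteq> verts G" "card e = k"
        by (auto simp: uniform_hypergraph_def)
      have "card (f ` e) = k"
        using e f by (metis bij_betw_def card_image inj_on_subset)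
      moreover have "f ` e \<subseteq> S" using e f by (auto simp: bij_betw_def)
      ultimately show ?thesis using S finite_subset by (auto simp: nsets_def)
    qed
    have "copy_of_in f G H"
      using f S img by (fastforce simp: copy_of_in_def H_def bij_betw_def nsets_def)
    moreover have "c (f ` e) = (i = 1)" if "e \<in> hedges G" for e
    proof -
      have "d (f ` e) = i" using mono img[OF that] by blast
      then show ?thesis by (auto simp: d_def split: if_splits)
    qed
    ultimately show "\<exists>f b. copy_of_in f G H \<and> (\<forall>e\<in>hedges G. c (f ` e) = b)" by blast
  qed
  ultimately show ?thesis by blast
qed

lemma size_ramsey_attained:
  fixes G :: "'b hypergraph"
  assumes "uniform_hypergraph k G"
  shows "\<exists>H :: nat hypergraph. uniform_hypergraph k H \<and> ramsey_arrow H G \<and>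
           card (hedges H) = size_ramsey k G"
proof -
  let ?A = "{card (hedges H) | H :: nat hypergraph. uniform_hypergraph k H \<and> ramsey_arrow H G}"
  have "?A \<noteq> {}" using ramsey_arrow_exists[OF assms] by blast
  then have "Inf ?A \<in> ?A" by (rule Inf_nat_def1)
  then obtain H :: "nat hypergraph" where "uniform_hypergraph k H" "ramsey_arrow H G"
    "Inf ?A = card (hedges H)" by blast
  then show ?thesis unfolding size_ramsey_def by metis
qed

lemma size_ramsey_le:
  fixes H :: "'a hypergraph" and G :: "'b hypergraph"
  assumes G: "uniform_hypergraph k G" and H: "uniform_hypergraph k H" and arrow: "ramsey_arrow H G"
  shows "size_ramsey k G \<le> card (hedges H)"
proof -
  have fin: "finite (verts H)" using H by (simp add: uniform_hypergraph_def)
  obtain g :: "'a \<Rightarrow> nat" where g: "inj_on g (verts H)"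
    using finite_imp_inj_to_nat_seg[OF fin] by blast
  define H' :: "nat hypergraph" where "H' = (g ` verts H, (`) g ` hedges H)"
  have edge: "e \<subseteq> verts H" "card e = k" if "e \<in> hedges H" for e
    using H that by (auto simp: uniform_hypergraph_def)
  have inj: "inj_on ((`) g) (hedges H)"
    by (rule inj_on_subset[OF inj_on_image_Pow[OF g]]) (use edge in auto)
  have "card (g ` e) = k" if "e \<in> hedges H" for e
    using edge[OF that] g by (metis card_image inj_on_subset)
  then have "uniform_hypergraph k H'"
    using fin edge by (auto simp: uniform_hypergraph_def H'_def)
  moreover have "ramsey_arrow H' G"
    unfolding ramsey_arrow_def
  proof
    fix c :: "nat set \<Rightarrow> bool"
    obtain f b where f: "copy_of_in f G H" and b: "\<forall>e\<in>hedges G. c (g ` (f ` e)) = b"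
      using arrow[unfolded ramsey_arrow_def, rule_format, of "\<lambda>e. c (g ` e)"] by blast
    have "copy_of_in (g \<circ> f) G H'"
      using f g unfolding copy_of_in_def H'_def
      by (auto simp: image_comp[symmetric] simp del: comp_apply intro!: comp_inj_on inj_on_subset[OF g])
    then show "\<exists>f b. copy_of_in f G H' \<and> (\<forall>e\<in>hedges G. c (f ` e) = b)"
      using b by (metis image_comp)
  qed
  moreover have "card (hedges H') = card (hedges H)"
    using card_image[OF inj] by (simp add: H'_def)
  ultimately show ?thesis
    unfolding size_ramsey_def by (intro cInf_lower CollectI exI[of _ H']) auto
qed

lemma uniform_tight_path:
  assumes "k \<ge> 1"
  shows "uniform_hypergraph k (tight_path k n)"
  using assms by (auto simp: uniform_hypergraph_def tight_path_def)

end

theory Submission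
  imports Defs "HOL-Library.Disjoint_Sets"
begin

text \<open>
  The host consists of the \<open>k\<close>-cliques of a random graph on \<open>N = C n\<close> vertices with edge probability
  \<open>p\<close> such that \<open>p ^ (k - 1) = A ln N / N\<close>; it has \<open>O (N ^ k * p ^ (k choose 2)) = O ((n ln n) powr (k / 2))\<close>
  edges, which is within the claimed bound because \<open>1 + \<alpha> \<le> k / 2\<close>. In the majority colour, pass to
  a subhypergraph in which every \<open>(k - 1)\<close>-set of its shadow lies in at least \<open>t\<close> edges, where \<open>t\<close>
  is a constant fraction of \<open>N * p ^ (k - 1)\<close>, and search depth-first for a tight path. Each path
  end that cannot be extended is a \<open>(k - 1)\<close>-set with \<open>t\<close> common neighbours inside the set \<open>X\<close> of used
  vertices, and these dead ends are pairwise disjoint. As \<open>|X| \<le> 3 n\<close> is a small fraction of \<open>N\<close>, a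
  first moment computation shows that the random graph does not have \<open>n div k\<close> such sets,
  so the search reaches length \<open>n\<close>.
\<close>

section \<open>Means over random subsets\<close>

text \<open>The probability that a random subset of \<open>E\<close>, keeping each element
  independently with probability \<open>p\<close>, equals \<open>G\<close>. Finite weighted sums
  stand in for a probability space.\<close>

definition subset_weight :: "real \<Rightarrow> 'a set \<Rightarrow> 'a set \<Rightarrow> real" where
  "subset_weight p E G = p ^ card G * (1 - p) ^ card (E - G)"

definition subset_mean :: "real \<Rightarrow> 'a set \<Rightarrow> ('a set \<Rightarrow> real) \<Rightarrow> real" where
  "subset_mean p E f = (\<Sum>G\<in>Pow E. subset_weight p E G * f G)"

text \<open>Expanding the product of \<open>p + g e\<close> over \<open>E\<close> runs through all
  subsets at once. Setting \<open>g\<close> to 0 on \<open>F\<close> kills every \<open>G\<close>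
  that misses part of \<open>F\<close>, and off \<open>F\<close> the factor \<open>p + g e\<close>
  is 1.\<close>

lemma subset_mean_contains:
  assumes E: "finite E" and F: "F \<subseteq> E"
  shows "subset_mean p E (\<lambda>G. of_bool (F \<subseteq> G)) = p ^ card F"
proof -
  define g where "g e = (if e \<in> F then 0 else 1 - p)" for e
  have "(\<Sum>G\<in>Pow E. subset_weight p E G * of_bool (F \<subseteq> G))
      = (\<Sum>G\<in>Pow E. (\<Prod>e\<in>G. p) * (\<Prod>e\<in>E - G. g e))"
  proof (rule sum.cong[OF refl])
    fix G assume G: "G \<in> Pow E"
    have fin: "finite (E - G)" using E by auto
    show "subset_weight p E G * of_bool (F \<subseteq> G) = (\<Prod>e\<in>G. p) * (\<Prod>e\<in>E - G. g e)"
    proof (cases "F \<subseteq> G")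
      case True
      then have "(\<Prod>e\<in>E - G. g e) = (\<Prod>e\<in>E - G. 1 - p)"
        by (intro prod.cong) (auto simp: g_def)
      then show ?thesis using True by (simp add: subset_weight_def)
    next
      case False
      then obtain e where "e \<in> F" "e \<notin> G" by auto
      then have "(\<Prod>e\<in>E - G. g e) = 0"
        using F fin by (intro prod_zero) (auto simp: g_def)
      then show ?thesis using False by simp
    qed
  qed
  also have "\<dots> = (\<Prod>e\<in>E. p + g e)"
    using prod_add[OF E, of "\<lambda>_. p" g] by simp
  also have "\<dots> = (\<Prod>e\<in>E. if e \<in> F then p else 1)"
    by (intro prod.cong) (auto simp: g_def)
  also have "\<dots> = p ^ card F"
    using E F by (simp add: prod.If_cases Int_absorb1 Int_absorb2)
  finally show ?thesis by (simp add: subset_mean_def)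
qed

lemma subset_weight_nonneg:
  "0 \<le> p \<Longrightarrow> p \<le> 1 \<Longrightarrow> 0 \<le> subset_weight p E G"
  by (simp add: subset_weight_def)

lemma subset_mean_sum:
  "subset_mean p E (\<lambda>G. \<Sum>i\<in>I. f i G) = (\<Sum>i\<in>I. subset_mean p E (f i))"
  unfolding subset_mean_def sum_distrib_left by (rule sum.swap)

lemma subset_mean_add:
  "subset_mean p E (\<lambda>G. f G + g G) = subset_mean p E f + subset_mean p E g"
  by (simp add: subset_mean_def algebra_simps sum.distrib)

lemma subset_mean_cmult:
  "subset_mean p E (\<lambda>G. c * f G) = c * subset_mean p E f"
  by (simp add: subset_mean_def sum_distrib_left mult_ac)

lemma subset_mean_cong:
  "(\<And>G. G \<subseteq> E \<Longrightarrow> f G = g G) \<Longrightarrow> subset_mean p E f = subset_mean p E g"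
  unfolding subset_mean_def by (intro sum.cong) auto

text \<open>The weights sum to 1, which is the previous identity for the empty set, so a mean below
  1 forces a value below 1. This is how a concrete graph is extracted from the random one.\<close>

lemma subset_mean_less_one:
  assumes "finite E" "0 \<le> p" "p \<le> 1" "subset_mean p E f < 1"
  shows "\<exists>G\<subseteq>E. f G < 1"
proof (rule ccontr)
  assume neg: "\<not> ?thesis"
  have ge: "f G \<ge> 1" if "G \<subseteq> E" for G using neg that by (meson not_less)
  have "1 = (\<Sum>G\<in>Pow E. subset_weight p E G)"
    using subset_mean_contains[of E "{}" p] assms(1) by (simp add: subset_mean_def)
  also have "\<dots> \<le> subset_mean p E f" unfolding subset_mean_def
  proof (rule sum_mono)
    fix G assume "G \<in> Pow E"
    then show "subset_weight p E G \<le> subset_weight p E G * f G"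
      using mult_left_mono[OF ge subset_weight_nonneg[OF assms(2,3)], of G E G] by simp
  qed
  finally show False using assms(4) by simp
qed

section \<open>Stars in random graphs\<close>

definition pairs :: "'a set \<Rightarrow> 'a set set" where
  "pairs V = {e. e \<subseteq> V \<and> card e = 2}"

definition common_nbrs :: "'a set \<Rightarrow> 'a set set \<Rightarrow> 'a set \<Rightarrow> 'a set" where
  "common_nbrs V G S = {w \<in> V - S. \<forall>b\<in>S. {b, w} \<in> G}"

text \<open>A pair \<open>(B, w)\<close> stands for the star with centre \<open>w\<close> and leaf
  set \<open>B\<close>.\<close>

definition star_edges :: "('a set \<times> 'a) set \<Rightarrow> 'a set set" where
  "star_edges Q = (\<Union>(B, w)\<in>Q. (\<lambda>b. {b, w}) ` B)"

text \<open>No pair of vertices is used twice by the stars of an oriented family.\<close>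

definition oriented :: "('a set \<times> 'a) set \<Rightarrow> bool" where
  "oriented Q \<longleftrightarrow> (\<forall>(B, w)\<in>Q. \<forall>(B', w')\<in>Q. \<not> (w \<in> B' \<and> w' \<in> B))"

lemma finite_pairs: "finite V \<Longrightarrow> finite (pairs V)"
  unfolding pairs_def by (rule finite_subset[of _ "Pow V"]) auto

lemma oriented_self: "oriented Q \<Longrightarrow> (B, w) \<in> Q \<Longrightarrow> w \<notin> B"
  unfolding oriented_def by fastforce

lemma star_edges_subset_pairs:
  assumes "oriented Q" "Q \<subseteq> BB \<times> V" "\<Union>BB \<subseteq> V"
  shows "star_edges Q \<subseteq> pairs V"
proof
  fix e assume "e \<in> star_edges Q"
  then obtain B w b where Q: "(B, w) \<in> Q" "b \<in> B" "e = {b, w}"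
    by (auto simp: star_edges_def)
  then have "w \<noteq> b" using oriented_self[OF assms(1)] by blast
  then show "e \<in> pairs V" using Q assms by (auto simp: pairs_def)
qed

text \<open>If \<open>{b, w} = {b', w'}\<close> crosswise, then \<open>w\<close> lies in
  \<open>B'\<close> and \<open>w'\<close> in \<open>B\<close>, which orientation forbids. Otherwise
  \<open>b = b'\<close> and \<open>w = w'\<close>, and disjointness of \<open>BB\<close> gives
  \<open>B = B'\<close>. So distinct stars share no edge.\<close>

lemma card_star_edges:
  assumes ori: "oriented Q" and Q: "finite Q" "Q \<subseteq> BB \<times> V"
    and disj: "disjoint BB" and BB: "\<And>B. B \<in> BB \<Longrightarrow> finite B \<and> card B = j"
  shows "card (star_edges Q) = j * card Q"
proof -
  have "card (star_edges Q) = (\<Sum>(B, w)\<in>Q. card ((\<lambda>b. {b, w}) ` B))"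
    unfolding star_edges_def
    apply (subst card_UN_disjoint)
    subgoal by (rule Q)
    subgoal using Q BB by fastforce
    subgoal
    proof (clarify)
      fix B w B' w'
      assume A: "(B, w) \<in> Q" "(B', w') \<in> Q"
        "(\<lambda>b. {b, w}) ` B \<inter> (\<lambda>b. {b, w'}) ` B' \<noteq> {}"
      then obtain b b' where b: "b \<in> B" "b' \<in> B'" "{b, w} = {b', w'}" by auto
      have "\<not> (w \<in> B' \<and> w' \<in> B)" using ori A by (fastforce simp: oriented_def)
      then have "b = b'" "w = w'" using b by (auto simp: doubleton_eq_iff)
      moreover have "B \<in> BB" "B' \<in> BB" using A Q by auto
      ultimately show "B = B' \<and> w = w'" using disj b by (auto simp: disjoint_def)
    qed
    subgoal by (simp add: case_prod_unfold)
    done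
  also have "\<dots> = (\<Sum>(B, w)\<in>Q. j)"
  proof (rule sum.cong[OF refl], clarify)
    fix B w assume A: "(B, w) \<in> Q"
    have "inj_on (\<lambda>b. {b, w}) B" using oriented_self[OF ori A]
      by (auto simp: inj_on_def doubleton_eq_iff)
    then show "card ((\<lambda>b. {b, w}) ` B) = j" using A Q BB by (subst card_image) auto
  qed
  finally show ?thesis by simp
qed

lemma subset_common_nbrs_iff:
  "A \<subseteq> V - S \<Longrightarrow> A \<subseteq> common_nbrs V G S \<longleftrightarrow> star_edges ({S} \<times> A) \<subseteq> G"
  by (auto simp: common_nbrs_def star_edges_def)

lemma sum_Pow_power:
  fixes x :: "'b :: comm_ring_1"
  assumes "finite A"
  shows "(\<Sum>B\<in>Pow A. x ^ card B) = (1 + x) ^ card A"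
  using prod_add[OF assms, of "\<lambda>_. x" "\<lambda>_. 1"] by (simp add: add.commute)

text \<open>Writing \<open>1/2\<close> as \<open>1 + (-1/2)\<close> turns the power into a signed
  sum over sets \<open>A\<close> of common neighbours, and \<open>A\<close> being such a set
  prescribes \<open>card S * card A\<close> distinct pairs. This exponential moment controls the
  lower tail of the number of common neighbours.\<close>

lemma subset_mean_half_power_nbrs:
  assumes V: "finite V" and S: "S \<subseteq> V"
  shows "subset_mean p (pairs V) (\<lambda>G. (1/2) ^ card (common_nbrs V G S))
       = (1 - p ^ card S / 2) ^ card (V - S)"
proof -
  have fin: "finite (V - S)" "finite S" using V S finite_subset by auto
  have "subset_mean p (pairs V) (\<lambda>G. (1/2) ^ card (common_nbrs V G S))
     = subset_mean p (pairs V)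
        (\<lambda>G. \<Sum>A\<in>Pow (V - S). (-1/2) ^ card A * of_bool (star_edges ({S} \<times> A) \<subseteq> G))"
  proof (rule subset_mean_cong)
    fix G
    have sub: "common_nbrs V G S \<subseteq> V - S" by (auto simp: common_nbrs_def)
    have "(1/2) ^ card (common_nbrs V G S) = (\<Sum>A\<in>Pow (common_nbrs V G S). (-1/2::real) ^ card A)"
      using sum_Pow_power[OF finite_subset[OF sub fin(1)], of "-1/2 :: real"] by simp
    also have "\<dots> = (\<Sum>A\<in>Pow (V - S). (-1/2) ^ card A * of_bool (A \<subseteq> common_nbrs V G S))"
      by (rule sum.mono_neutral_cong_left) (use fin sub in auto)
    also have "\<dots> = (\<Sum>A\<in>Pow (V - S). (-1/2) ^ card A * of_bool (star_edges ({S} \<times> A) \<subseteq> G))"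
      by (intro sum.cong refl arg_cong2[where f = "(*)"] arg_cong[where f = of_bool])
        (simp add: subset_common_nbrs_iff)
    finally show "(1/2) ^ card (common_nbrs V G S) =
      (\<Sum>A\<in>Pow (V - S). (-1/2::real) ^ card A * of_bool (star_edges ({S} \<times> A) \<subseteq> G))" .
  qed
  also have "\<dots> = (\<Sum>A\<in>Pow (V - S). (-1/2) ^ card A * p ^ (card S * card A))"
    unfolding subset_mean_sum subset_mean_cmult
  proof (intro sum.cong refl arg_cong2[where f = "(*)"])
    fix A assume A: "A \<in> Pow (V - S)"
    have ori: "oriented ({S} \<times> A)" using A by (auto simp: oriented_def)
    have finA: "finite A" using A fin finite_subset by auto
    have "card (star_edges ({S} \<times> A)) = card S * card ({S} \<times> A)"
      by (rule card_star_edges[OF ori, of "{S}" V]) (use A fin finA in auto)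
    then have "card (star_edges ({S} \<times> A)) = card S * card A"
      by (simp add: card_cartesian_product)
    moreover have "star_edges ({S} \<times> A) \<subseteq> pairs V"
      by (rule star_edges_subset_pairs[OF ori, of "{S}"]) (use A S in auto)
    ultimately show "subset_mean p (pairs V) (\<lambda>G. of_bool (star_edges ({S} \<times> A) \<subseteq> G))
        = p ^ (card S * card A)"
      using subset_mean_contains[OF finite_pairs[OF V]] by metis
  qed
  also have "\<dots> = (\<Sum>A\<in>Pow (V - S). (- (p ^ card S / 2)) ^ card A)"
    by (intro sum.cong refl) (simp add: power_mult power_mult_distrib[symmetric])
  also have "\<dots> = (1 - p ^ card S / 2) ^ card (V - S)"
    using sum_Pow_power[OF fin(1), of "- (p ^ card S / 2)"] by simp
  finally show ?thesis .
qed

section \<open>First moment bound for families of stars\<close>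

lemma binomial_le_exp_power:
  assumes "0 < s"
  shows "real (m choose s) \<le> (exp 1 * real m / real s) ^ s"
proof -
  have "real s ^ s / fact s \<le> exp (real s)"
  proof -
    \<comment> \<open>A single term of the exponential series at \<open>s\<close> is at most its
      sum.\<close>
    have "(\<Sum>i\<in>{s}. real s ^ i /\<^sub>R fact i) \<le> exp (real s)"
      unfolding exp_def by (rule sum_le_suminf[OF summable_exp_generic]) auto
    then show ?thesis by (simp add: divide_inverse mult.commute)
  qed
  then have f: "real s ^ s \<le> exp 1 ^ s * fact s"
    by (simp add: divide_le_eq flip: exp_of_nat_mult)
  have b: "real (m choose s) * fact s \<le> real m ^ s"
    using of_nat_mono[OF binomial_fact_pow[of m s], where ?'a = real] by simp
  have "real (m choose s) * real s ^ s \<le> real (m choose s) * (exp 1 ^ s * fact s)"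
    by (intro mult_left_mono f) auto
  also have "\<dots> \<le> exp 1 ^ s * real m ^ s" using b by (simp add: mult_ac)
  finally show ?thesis using assms by (simp add: power_divide power_mult_distrib pos_le_divide_eq)
qed

text \<open>The witnesses of a bad event. For \<open>BB = {S}\<close> and \<open>X = V\<close> they
  amount to sets of \<open>s\<close> common neighbours of \<open>S\<close>; for a family of dead
  ends they record many extensions into \<open>X\<close>.\<close>

definition overfull :: "nat \<Rightarrow> 'a set set \<Rightarrow> 'a set set \<Rightarrow> 'a set \<Rightarrow> ('a set \<times> 'a) set set" where
  "overfull s G BB X = {Q. Q \<subseteq> BB \<times> X \<and> card Q = s \<and> oriented Q \<and> star_edges Q \<subseteq> G}"

text \<open>Union bound: there are at most \<open>card BB * card X choose s\<close> families, and
  each prescribes exactly \<open>j * s\<close> distinct pairs by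
  \<open>card_star_edges\<close>.\<close>

lemma subset_mean_overfull:
  assumes V: "finite V" and X: "X \<subseteq> V" and disj: "disjoint BB" and p: "0 \<le> p"
    and BB: "finite BB" "\<And>B. B \<in> BB \<Longrightarrow> B \<subseteq> V \<and> card B = j" and s: "0 < s"
  shows "subset_mean p (pairs V) (\<lambda>G. real (card (overfull s G BB X)))
       \<le> (exp 1 * real (card BB) * real (card X) * p ^ j / real s) ^ s"
proof -
  define I where "I = {Q. Q \<subseteq> BB \<times> X \<and> card Q = s \<and> oriented Q}"
  have finX: "finite (BB \<times> X)" using finite_subset[OF X V] BB(1) by auto
  have finI: "finite I" unfolding I_def
    by (rule finite_subset[of _ "Pow (BB \<times> X)"]) (use finX in auto)
  have "overfull s G BB X = {Q \<in> I. star_edges Q \<subseteq> G}" for G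
    by (auto simp: overfull_def I_def)
  then have "real (card (overfull s G BB X)) = (\<Sum>Q\<in>I. of_bool (star_edges Q \<subseteq> G))" for G
    using finI by (simp add: of_bool_def sum.If_cases Int_def)
  then have "subset_mean p (pairs V) (\<lambda>G. real (card (overfull s G BB X)))
      = (\<Sum>Q\<in>I. subset_mean p (pairs V) (\<lambda>G. of_bool (star_edges Q \<subseteq> G)))"
    by (simp add: subset_mean_sum)
  also have "\<dots> = (\<Sum>Q\<in>I. (p ^ j) ^ s)"
  proof (rule sum.cong[OF refl])
    fix Q assume Q: "Q \<in> I"
    then have ori: "oriented Q" and QB: "Q \<subseteq> BB \<times> X" "card Q = s" by (auto simp: I_def)
    have QV: "Q \<subseteq> BB \<times> V" using QB X by auto
    have finB: "finite B" if "B \<in> BB" for B using BB(2)[OF that] V finite_subset by auto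
    have "card (star_edges Q) = j * card Q"
      by (rule card_star_edges[OF ori _ QV disj])
        (use finB BB finite_subset[OF QB(1) finX] in auto)
    moreover have "star_edges Q \<subseteq> pairs V"
      by (rule star_edges_subset_pairs[OF ori QV]) (use BB in auto)
    ultimately show "subset_mean p (pairs V) (\<lambda>G. of_bool (star_edges Q \<subseteq> G)) = (p ^ j) ^ s"
      using subset_mean_contains[OF finite_pairs[OF V], of "star_edges Q" p] QB by (simp add: power_mult)
  qed
  also have "\<dots> = real (card I) * (p ^ j) ^ s" by simp
  also have "\<dots> \<le> (exp 1 * real (card BB * card X) / real s) ^ s * (p ^ j) ^ s"
  proof (rule mult_right_mono)
    have "card I \<le> card {Q. Q \<subseteq> BB \<times> X \<and> card Q = s}"
      by (rule card_mono) (auto simp: I_def intro: finite_subset[of _ "Pow (BB \<times> X)"] finX)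
    also have "\<dots> = (card BB * card X) choose s"
      using n_subsets[OF finX] by (simp add: card_cartesian_product)
    finally have "real (card I) \<le> real ((card BB * card X) choose s)" by simp
    also note binomial_le_exp_power[OF s]
    finally show "real (card I) \<le> (exp 1 * real (card BB * card X) / real s) ^ s" .
  qed (use p in simp)
  also have "\<dots> = (exp 1 * real (card BB) * real (card X) * p ^ j / real s) ^ s"
    by (simp add: mult_ac flip: power_mult_distrib)
  finally show ?thesis .
qed

section \<open>Counting cliques\<close>

text \<open>The parameter \<open>Z\<close> lets one double count serve both for all cliques
  (\<open>Z = {}\<close>) and for those through a vertex (\<open>Z = {v}\<close>).\<close>

definition cliques :: "'a set \<Rightarrow> 'a set set \<Rightarrow> 'a set \<Rightarrow> nat \<Rightarrow> 'a set set" where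
  "cliques V G Z j = {S. Z \<subseteq> S \<and> S \<subseteq> V \<and> card S = j \<and> pairs S \<subseteq> G}"

lemma finite_cliques: "finite V \<Longrightarrow> finite (cliques V G Z j)"
  unfolding cliques_def by (rule finite_subset[of _ "Pow V"]) auto

lemma pairs_insert:
  assumes "w \<notin> S"
  shows "pairs (insert w S) = pairs S \<union> (\<lambda>b. {b, w}) ` S"
proof
  show "pairs (insert w S) \<subseteq> pairs S \<union> (\<lambda>b. {b, w}) ` S"
  proof
    fix e assume "e \<in> pairs (insert w S)"
    then obtain x y where xy: "e = {x, y}" "x \<noteq> y" "e \<subseteq> insert w S"
      by (auto simp: pairs_def card_2_iff)
    show "e \<in> pairs S \<union> (\<lambda>b. {b, w}) ` S"
    proof (cases "w \<in> e")
      case True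
      then have "e = {x, w} \<and> x \<in> S \<or> e = {y, w} \<and> y \<in> S" using xy by auto
      then show ?thesis by auto
    next
      case False
      then show ?thesis using xy by (auto simp: pairs_def)
    qed
  qed
  show "pairs S \<union> (\<lambda>b. {b, w}) ` S \<subseteq> pairs (insert w S)"
    using assms by (auto simp: pairs_def card_2_iff)
qed

text \<open>Double counting: a clique \<open>S\<close> with a common neighbour \<open>w\<close>
  corresponds to the clique \<open>T = insert w S\<close> with a marked vertex outside
  \<open>Z\<close>.\<close>

lemma sum_card_common_nbrs_cliques:
  assumes V: "finite V" and Z: "Z \<subseteq> V" "card Z \<le> j"
  shows "(\<Sum>S\<in>cliques V G Z j. card (common_nbrs V G S))
       = (Suc j - card Z) * card (cliques V G Z (Suc j))"
proof -
  have fin: "finite S" if "S \<subseteq> V" for S using that V finite_subset by auto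
  have finN: "finite (common_nbrs V G S)" for S
    by (rule fin) (auto simp: common_nbrs_def)
  let ?P = "SIGMA S:cliques V G Z j. common_nbrs V G S"
  let ?Q = "SIGMA T:cliques V G Z (Suc j). T - Z"
  have "bij_betw (\<lambda>(S, w). (insert w S, w)) ?P ?Q"
  proof (rule bij_betw_byWitness[where f' = "\<lambda>(T, w). (T - {w}, w)"])
    show "\<forall>a\<in>?P. (\<lambda>(T, w). (T - {w}, w)) ((\<lambda>(S, w). (insert w S, w)) a) = a"
      by (auto simp: common_nbrs_def)
    show "\<forall>a\<in>?Q. (\<lambda>(S, w). (insert w S, w)) ((\<lambda>(T, w). (T - {w}, w)) a) = a"
      by auto
    show "(\<lambda>(S, w). (insert w S, w)) ` ?P \<subseteq> ?Q"
    proof clarify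
      fix S w assume "S \<in> cliques V G Z j" "w \<in> common_nbrs V G S"
      then show "insert w S \<in> cliques V G Z (Suc j) \<and> w \<in> insert w S - Z"
        using fin[of S] by (auto simp: cliques_def common_nbrs_def pairs_insert)
    qed
    show "(\<lambda>(T, w). (T - {w}, w)) ` ?Q \<subseteq> ?P"
    proof clarify
      fix T w assume A: "T \<in> cliques V G Z (Suc j)" "w \<in> T" "w \<notin> Z"
      then have "pairs (insert w (T - {w})) \<subseteq> G" by (simp add: cliques_def insert_absorb)
      then have "pairs (T - {w}) \<union> (\<lambda>b. {b, w}) ` (T - {w}) \<subseteq> G"
        by (subst (asm) pairs_insert) auto
      then show "T - {w} \<in> cliques V G Z j \<and> w \<in> common_nbrs V G (T - {w})"
        using A fin[of T] by (auto simp: cliques_def common_nbrs_def)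
    qed
  qed
  then have "card ?P = card ?Q" by (rule bij_betw_same_card)
  moreover have "card ?P = (\<Sum>S\<in>cliques V G Z j. card (common_nbrs V G S))"
    using finite_cliques[OF V] finN by (intro card_SigmaI) auto
  moreover have "card ?Q = (\<Sum>T\<in>cliques V G Z (Suc j). card (T - Z))"
    using finite_cliques[OF V] fin by (intro card_SigmaI) (auto simp: cliques_def)
  moreover have "(\<Sum>T\<in>cliques V G Z (Suc j). card (T - Z))
      = (\<Sum>T\<in>cliques V G Z (Suc j). Suc j - card Z)"
    using fin[OF Z(1)] by (intro sum.cong refl) (auto simp: cliques_def card_Diff_subset)
  ultimately show ?thesis by simp
qed

text \<open>The number of common neighbours has the order of its expectation. The factors 1/8 and 9
  are those that the tail estimates in \<open>random_graph_exists\<close> deliver, 9 being a bound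
  for \<open>exp 2\<close>.\<close>

definition nbr_regular :: "nat \<Rightarrow> real \<Rightarrow> 'a set \<Rightarrow> 'a set set \<Rightarrow> bool" where
  "nbr_regular k p V G \<longleftrightarrow> (\<forall>S\<subseteq>V. card S < k \<longrightarrow>
     real (card V) * p ^ card S / 8 \<le> real (card (common_nbrs V G S)) \<and>
     real (card (common_nbrs V G S)) \<le> 9 * real (card V) * p ^ card S)"

lemma card_cliques_Suc_ge:
  assumes V: "finite V" and reg: "nbr_regular k p V G" and j: "j < k"
  shows "real (card (cliques V G {} j)) * (real (card V) * p ^ j / 8)
       \<le> real (Suc j) * real (card (cliques V G {} (Suc j)))"
proof -
  have "real (card (cliques V G {} j)) * (real (card V) * p ^ j / 8)
      = (\<Sum>S\<in>cliques V G {} j. real (card V) * p ^ j / 8)" by simp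
  also have "\<dots> \<le> (\<Sum>S\<in>cliques V G {} j. real (card (common_nbrs V G S)))"
    using reg j by (intro sum_mono) (auto simp: nbr_regular_def cliques_def)
  also have "\<dots> = real (Suc j) * real (card (cliques V G {} (Suc j)))"
    using sum_card_common_nbrs_cliques[OF V, of "{}" j G]
    by (simp del: of_nat_Suc of_nat_mult flip: of_nat_sum of_nat_mult)
  finally show ?thesis .
qed

lemma card_cliques_Suc_le:
  assumes V: "finite V" and reg: "nbr_regular k p V G" and j: "j < k"
    and Z: "Z \<subseteq> V" "card Z \<le> j"
  shows "real (Suc j - card Z) * real (card (cliques V G Z (Suc j)))
       \<le> real (card (cliques V G Z j)) * (9 * real (card V) * p ^ j)"
proof -
  have "real (Suc j - card Z) * real (card (cliques V G Z (Suc j)))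
      = (\<Sum>S\<in>cliques V G Z j. real (card (common_nbrs V G S)))"
    using sum_card_common_nbrs_cliques[OF V Z, of G]
    by (simp del: of_nat_Suc of_nat_mult flip: of_nat_sum of_nat_mult)
  also have "\<dots> \<le> (\<Sum>S\<in>cliques V G Z j. 9 * real (card V) * p ^ j)"
    using reg j by (intro sum_mono) (auto simp: nbr_regular_def cliques_def)
  finally show ?thesis by simp
qed

lemma card_cliques_pos:
  assumes V: "finite V" "V \<noteq> {}" and reg: "nbr_regular k p V G" and p: "0 < p"
  shows "j \<le> k \<Longrightarrow> 0 < card (cliques V G {} j)"
proof (induction j)
  case 0
  have "cliques V G {} 0 = {{}}"
    using finite_subset[OF _ V(1)] by (auto simp: cliques_def pairs_def)
  then show ?case by simp
next
  case (Suc j)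
  have "0 < card V" using V by (simp add: card_gt_0_iff)
  then have "0 < real (card (cliques V G {} j)) * (real (card V) * p ^ j / 8)"
    using Suc p by (intro mult_pos_pos divide_pos_pos) auto
  also have "\<dots> \<le> real (Suc j) * real (card (cliques V G {} (Suc j)))"
    using card_cliques_Suc_ge[OF V(1) reg, of j] Suc by simp
  finally show ?case by (simp add: zero_less_mult_iff)
qed

lemma card_cliques_le:
  assumes V: "finite V" and reg: "nbr_regular k p V G" and p: "0 \<le> p"
  shows "j \<le> k \<Longrightarrow> real (card (cliques V G {} j)) \<le> 9 ^ j * real (card V) ^ j * p ^ (j choose 2)"
proof (induction j)
  case 0
  have "cliques V G {} 0 \<subseteq> {{}}"
    using finite_subset[OF _ V] by (auto simp: cliques_def)
  from card_mono[OF _ this] show ?case by (simp add: binomial_eq_0)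
next
  case (Suc j)
  have "real (card (cliques V G {} (Suc j))) \<le> real (Suc j) * real (card (cliques V G {} (Suc j)))"
    by (simp add: mult_le_cancel_right1)
  also have "\<dots> \<le> real (card (cliques V G {} j)) * (9 * real (card V) * p ^ j)"
    using card_cliques_Suc_le[OF V reg, of j "{}"] Suc by simp
  also have "\<dots> \<le> (9 ^ j * real (card V) ^ j * p ^ (j choose 2)) * (9 * real (card V) * p ^ j)"
    using Suc p by (intro mult_right_mono) auto
  also have "\<dots> = 9 ^ Suc j * real (card V) ^ Suc j * p ^ (Suc j choose 2)"
    by (simp add: numeral_2_eq_2 power_add mult_ac)
  finally show ?case .
qed

text \<open>No vertex lies in much more than its share of cliques. Adding one vertex changes the
  ratio by at most \<open>72 = 9 * 8\<close>, the quotient of the regularity constants, times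
  \<open>(j + 2) / (j + 1)\<close>; the latter factors telescope to \<open>Suc j\<close>.\<close>

lemma card_cliques_at_vertex:
  assumes V: "finite V" and reg: "nbr_regular k p V G" and p: "0 \<le> p" and v: "v \<in> V"
  shows "Suc j \<le> k \<Longrightarrow> real (card V) * real (card (cliques V G {v} (Suc j)))
    \<le> real (Suc j) * 72 ^ Suc j * real (card (cliques V G {} (Suc j)))"
proof (induction j)
  case 0
  have "cliques V G {v} (Suc 0) \<subseteq> {{v}}"
    by (auto simp: cliques_def card_Suc_eq)
  from card_mono[OF _ this] have 1: "real (card (cliques V G {v} (Suc 0))) \<le> 1" by simp
  have "(\<lambda>x. {x}) ` V \<subseteq> cliques V G {} (Suc 0)"
    by (auto simp: cliques_def pairs_def card_2_iff)
  from card_mono[OF finite_cliques[OF V] this]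
  have "card V \<le> card (cliques V G {} (Suc 0))" by (simp add: card_image)
  then show ?case using mult_left_mono[OF 1, of "real (card V)"] by simp
next
  case (Suc j)
  define N where "N = real (card V)"
  define a b where "a = real (card (cliques V G {v} (Suc j)))"
    and "b = real (card (cliques V G {} (Suc j)))"
  define a' b' where "a' = real (card (cliques V G {v} (Suc (Suc j))))"
    and "b' = real (card (cliques V G {} (Suc (Suc j))))"
  have nn: "0 \<le> N" "0 \<le> N * p ^ Suc j" using p by (auto simp: N_def)
  \<comment> \<open>One of the \<open>Suc (Suc j)\<close> vertices is \<open>v\<close> itself, so
    only \<open>Suc j\<close> of them can be the added one.\<close>
  have up: "real (Suc j) * a' \<le> a * (9 * N * p ^ Suc j)"
    using card_cliques_Suc_le[OF V reg, of "Suc j" "{v}"] Suc.prems v by (simp add: a_def a'_def N_def)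
  have lo: "b * (N * p ^ Suc j / 8) \<le> real (Suc (Suc j)) * b'"
    using card_cliques_Suc_ge[OF V reg, of "Suc j"] Suc.prems by (simp only: b_def b'_def N_def)
  have IH: "N * a \<le> real (Suc j) * 72 ^ Suc j * b"
    using Suc by (simp add: a_def b_def N_def)
  have "real (Suc j) * (N * a') = N * (real (Suc j) * a')" by simp
  also have "\<dots> \<le> N * (a * (9 * N * p ^ Suc j))" by (rule mult_left_mono[OF up nn(1)])
  also have "\<dots> = (N * a) * (9 * (N * p ^ Suc j))" by simp
  also have "\<dots> \<le> (real (Suc j) * 72 ^ Suc j * b) * (9 * (N * p ^ Suc j))"
    by (rule mult_right_mono[OF IH]) (use nn in simp)
  also have "\<dots> = real (Suc j) * 72 ^ Suc (Suc j) * (b * (N * p ^ Suc j / 8))" by simp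
  also have "\<dots> \<le> real (Suc j) * 72 ^ Suc (Suc j) * (real (Suc (Suc j)) * b')"
    by (rule mult_left_mono[OF lo]) simp
  finally have "real (Suc j) * (N * a') \<le> real (Suc j) * (real (Suc (Suc j)) * 72 ^ Suc (Suc j) * b')"
    by (simp only: mult_ac)
  then have "N * a' \<le> real (Suc (Suc j)) * 72 ^ Suc (Suc j) * b'"
    by (rule mult_left_le_imp_le) simp
  then show ?case by (simp only: N_def a'_def b'_def)
qed

text \<open>Union bound over the vertices of \<open>X\<close>. It shows that a small set of used
  vertices cannot block all edges of a dense colour.\<close>

lemma card_cliques_meeting_le:
  assumes V: "finite V" and reg: "nbr_regular k p V G" and p: "0 \<le> p" and k: "1 \<le> k"
    and X: "X \<subseteq> V"
  shows "real (card V) * real (card {e \<in> cliques V G {} k. e \<inter> X \<noteq> {}})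
    \<le> real (card X) * (real k * 72 ^ k * real (card (cliques V G {} k)))"
proof -
  have finX: "finite X" using X V finite_subset by auto
  have "{e \<in> cliques V G {} k. e \<inter> X \<noteq> {}} \<subseteq> (\<Union>v\<in>X. cliques V G {v} k)"
    by (auto simp: cliques_def)
  then have "card {e \<in> cliques V G {} k. e \<inter> X \<noteq> {}} \<le> card (\<Union>v\<in>X. cliques V G {v} k)"
    using finX finite_cliques[OF V] by (intro card_mono) auto
  also have "\<dots> \<le> (\<Sum>v\<in>X. card (cliques V G {v} k))" by (rule card_UN_le[OF finX])
  finally have "real (card V) * real (card {e \<in> cliques V G {} k. e \<inter> X \<noteq> {}})
      \<le> real (card V) * real (\<Sum>v\<in>X. card (cliques V G {v} k))"
    by (intro mult_left_mono of_nat_mono) auto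
  also have "\<dots> = (\<Sum>v\<in>X. real (card V) * real (card (cliques V G {v} k)))"
    by (simp add: sum_distrib_left)
  also have "\<dots> \<le> (\<Sum>v\<in>X. real k * 72 ^ k * real (card (cliques V G {} k)))"
    using card_cliques_at_vertex[OF V reg p, of _ "k - 1"] X k by (intro sum_mono) auto
  finally show ?thesis by simp
qed

section \<open>Searching for a tight path\<close>

definition shadow :: "nat \<Rightarrow> 'a set set \<Rightarrow> 'a set set" where
  "shadow k R = {B. card B = k - 1 \<and> (\<exists>e\<in>R. B \<subseteq> e)}"

lemma finite_shadow:
  assumes "finite R" "\<And>e. e \<in> R \<Longrightarrow> finite e"
  shows "finite (shadow k R)"
  by (rule finite_subset[of _ "Pow (\<Union>R)"]) (use assms in \<open>auto simp: shadow_def\<close>)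

text \<open>Take a subset maximizing \<open>card R' - t * card (shadow k R')\<close>: deleting all edges through a
  shadow element of degree less than \<open>t\<close> would increase this quantity.\<close>

lemma subhypergraph_large_codegree:
  fixes t :: real and R :: "'a set set"
  assumes R: "finite R" "\<And>e. e \<in> R \<Longrightarrow> finite e"
  obtains R' where "R' \<subseteq> R" "real (card R) - t * real (card (shadow k R))
        \<le> real (card R') - t * real (card (shadow k R'))"
    "\<And>B. B \<in> shadow k R' \<Longrightarrow> t \<le> real (card {e \<in> R'. B \<subseteq> e})"
proof -
  define \<phi> where "\<phi> R' = real (card R') - t * real (card (shadow k R'))" for R' :: "'a set set"
  have "Max (\<phi> ` Pow R) \<in> \<phi> ` Pow R" using R(1) by (intro Max_in) auto
  then obtain R' where R': "R' \<in> Pow R" and Max: "\<phi> R' = Max (\<phi> ` Pow R)" by force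
  have max: "\<phi> R'' \<le> \<phi> R'" if "R'' \<in> Pow R" for R''
    unfolding Max using R(1) that by (intro Max_ge) auto
  have finR': "finite R'" using R' R finite_subset by auto
  have finS: "finite (shadow k R')" using R R' by (intro finite_shadow finR') auto
  have "t \<le> real (card {e \<in> R'. B \<subseteq> e})" if B: "B \<in> shadow k R'" for B
  proof (rule ccontr)
    assume small: "\<not> ?thesis"
    define D where "D = {e \<in> R'. B \<subseteq> e}"
    have D: "D \<subseteq> R'" by (auto simp: D_def)
    \<comment> \<open>A codegree is nonnegative, so one below \<open>t\<close> forces
      \<open>t\<close> to be positive.\<close>
    have tpos: "0 < t" using small by linarith
    have "shadow k (R' - D) \<subseteq> shadow k R' - {B}" by (auto simp: shadow_def D_def)
    then have "card (shadow k (R' - D)) \<le> card (shadow k R' - {B})"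
      using finS by (intro card_mono) auto
    also have "\<dots> < card (shadow k R')" using B finS by (intro card_Diff1_less)
    finally have "card (shadow k (R' - D)) + 1 \<le> card (shadow k R')" by simp
    then have "t * (real (card (shadow k (R' - D))) + 1) \<le> t * real (card (shadow k R'))"
      using tpos by (intro mult_left_mono) linarith+
    moreover have "real (card (R' - D)) = real (card R') - real (card D)"
      using D finR' by (simp add: card_Diff_subset finite_subset card_mono of_nat_diff)
    ultimately have "\<phi> R' < \<phi> (R' - D)" using small by (simp add: \<phi>_def D_def algebra_simps)
    moreover have "\<phi> (R' - D) \<le> \<phi> R'" using R' by (intro max) auto
    ultimately show False by simp
  qed
  then show ?thesis using that[of R'] R' max[of R] by (auto simp: \<phi>_def)
qed

text \<open>Depth-first search with deletion. The head of \<open>P\<close> is the end of the current path, \<open>X\<close> is the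
  set of vertices used so far, and \<open>BB\<close> collects the path ends that could not be extended outside
  \<open>X\<close>. When a path end dies, its \<open>k - 1\<close> vertices are removed from the path.\<close>

lemma tight_path_by_search:
  fixes V :: "'a set" and R :: "'a set set"
  assumes k: "2 \<le> k" "k \<le> n" and V: "finite V"
    and R: "\<And>e. e \<in> R \<Longrightarrow> e \<subseteq> V \<and> card e = k"
    and avoid: "\<And>X. X \<subseteq> V \<Longrightarrow> card X \<le> 3 * n \<Longrightarrow> \<exists>e\<in>R. e \<inter> X = {}"
    and dead: "\<And>BB X. disjoint BB \<Longrightarrow> card BB = M \<Longrightarrow> BB \<subseteq> shadow k R \<Longrightarrow> X \<subseteq> V \<Longrightarrow>
        card X \<le> 3 * n \<Longrightarrow> \<exists>B\<in>BB. \<exists>w. w \<notin> X \<and> insert w B \<in> R"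
    and M: "k * M \<le> n"
  shows "\<exists>P. distinct P \<and> length P = n \<and> set P \<subseteq> V \<and>
           (\<forall>i. i + k \<le> n \<longrightarrow> set (take k (drop i P)) \<in> R)"
proof (rule ccontr)
  assume no_path: "\<not> ?thesis"
  \<comment> \<open>Here \<open>m\<close> counts the dead ends. Each death discards the
    \<open>k - 1\<close> end vertices and possibly a remainder of fewer than \<open>k\<close>
    vertices, at most \<open>2 * k\<close> in all, hence the bound on \<open>card X\<close>.\<close>
  define state where "state m P X BB \<longleftrightarrow>
     distinct P \<and> set P \<subseteq> X \<and> X \<subseteq> V \<and> card X \<le> length P + 2 * k * m \<and>
     (\<forall>i. i + k \<le> length P \<longrightarrow> set (take k (drop i P)) \<in> R) \<and>
     (P = [] \<or> k \<le> length P) \<and> length P \<le> n \<and>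
     finite BB \<and> card BB = m \<and> disjoint BB \<and> BB \<subseteq> shadow k R \<and>
     (\<forall>B\<in>BB. B \<inter> set P = {} \<and> B \<subseteq> X \<and> (\<forall>w. insert w B \<in> R \<longrightarrow> w \<in> X))" for m P X BB
  \<comment> \<open>The path has at most \<open>n\<close> vertices, and \<open>2 * k * m\<close> is
    at most \<open>2 * n\<close>.\<close>
  have size: "card X \<le> 3 * n" if "state m P X BB" "m \<le> M" for m P X BB
  proof -
    have "k * m \<le> n" using M mult_le_mono2[OF that(2), of k] by linarith
    then show ?thesis using that(1) by (simp add: state_def)
  qed
  \<comment> \<open>Induction on the number of dead ends: without a path of length \<open>n\<close>,
    a longest path among the states with \<open>m\<close> dead ends is stuck and supplies the next
    one. At \<open>M\<close> dead ends, \<open>dead\<close> is contradicted.\<close>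
  have "\<exists>P X BB. state m P X BB" if "m \<le> M" for m
    using that
  proof (induction m)
    case 0
    have "state 0 [] {} {}" using k by (simp add: state_def disjoint_def)
    then show ?case by blast
  next
    case (Suc m)
    \<comment> \<open>Maximality over all states with \<open>m\<close> dead ends, whatever their
      \<open>X\<close> and \<open>BB\<close>, replaces running the search step by step.\<close>
    define S where "S = {P. \<exists>X BB. state m P X BB}"
    obtain P0 where "P0 \<in> S" using Suc by (auto simp: S_def)
    moreover have "\<forall>P. P \<in> S \<longrightarrow> length P < Suc n" by (auto simp: S_def state_def)
    ultimately obtain P where P: "P \<in> S" and maxP: "\<And>P'. P' \<in> S \<Longrightarrow> length P' \<le> length P"
      using ex_has_greatest_nat[of "\<lambda>P. P \<in> S" P0 length "Suc n"] by metis
    from P obtain X BB where st: "state m P X BB" unfolding S_def by blast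
    note s = st[unfolded state_def]
    have XV: "X \<subseteq> V" using s by simp
    have finX: "finite X" by (rule finite_subset[OF XV V])
    have Xsize: "card X \<le> 3 * n" using size[OF st] Suc.prems by simp
    have kP: "k \<le> length P"
    proof (rule ccontr)
      assume "\<not> k \<le> length P"
      then have P0: "P = []" using s by auto
      obtain e where e: "e \<in> R" "e \<inter> X = {}" using avoid[OF XV Xsize] by blast
      have e': "e \<subseteq> V" "card e = k" using R[OF e(1)] by auto
      obtain P' where P': "set P' = e" "distinct P'"
        using finite_distinct_list finite_subset[OF e'(1) V] by blast
      have len: "length P' = k" using P' e' distinct_card by fastforce
      have "state m P' (X \<union> e) BB"
        unfolding state_def
      proof (intro conjI)
        show "card (X \<union> e) \<le> length P' + 2 * k * m"
          using card_Un_le[of X e] s P0 e' len by simp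
        show "\<forall>i. i + k \<le> length P' \<longrightarrow> set (take k (drop i P')) \<in> R"
          using len P' e by auto
        show "\<forall>B\<in>BB. B \<inter> set P' = {} \<and> B \<subseteq> X \<union> e \<and> (\<forall>w. insert w B \<in> R \<longrightarrow> w \<in> X \<union> e)"
          using s e P' by blast
      qed (use s P' e e' len k in auto)
      then have "length P' \<le> length P" using maxP by (auto simp: S_def)
      then show False using len k P0 by simp
    qed
    have Pn: "length P < n"
    proof (rule ccontr)
      assume "\<not> length P < n"
      then have "length P = n" using s by simp
      then show False using no_path s by (metis order_trans)
    qed
    define B where "B = set (take (k - 1) P)"
    have cardB: "card B = k - 1"
      using s kP by (simp add: B_def distinct_card)
    have "set (take k P) \<in> R" using s kP by (metis add_0 drop0)
    then have Bsh: "B \<in> shadow k R"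
      unfolding shadow_def using cardB set_take_subset_set_take[of "k - 1" k P] by (auto simp: B_def)
    have BP: "B \<subseteq> set P" by (auto simp: B_def dest: in_set_takeD)
    have stuck: "w \<in> X" if w: "insert w B \<in> R" for w
    proof (rule ccontr)
      assume wX: "w \<notin> X"
      have "state m (w # P) (insert w X) BB"
        unfolding state_def
      proof (intro conjI)
        show "distinct (w # P)" using s wX by auto
        show "insert w X \<subseteq> V" using s R[OF w] by auto
        show "card (insert w X) \<le> length (w # P) + 2 * k * m"
          using s wX finX by simp
        show "\<forall>i. i + k \<le> length (w # P) \<longrightarrow> set (take k (drop i (w # P))) \<in> R"
        proof (intro allI impI)
          fix i assume i: "i + k \<le> length (w # P)"
          show "set (take k (drop i (w # P))) \<in> R"
          proof (cases i)
            case 0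
            \<comment> \<open>The first window of \<open>w # P\<close> consists of \<open>w\<close>
              and the first \<open>k - 1\<close> vertices of \<open>P\<close>, that is,
              \<open>insert w B\<close>.\<close>
            then show ?thesis using w k by (cases k) (auto simp: B_def)
          next
            case (Suc i')
            then show ?thesis using s i by auto
          qed
        qed
        \<comment> \<open>Dead ends stay dead because \<open>X\<close> only grows, and they avoid
          \<open>w\<close> because they lie inside the old \<open>X\<close>.\<close>
        show "\<forall>B\<in>BB. B \<inter> set (w # P) = {} \<and> B \<subseteq> insert w X \<and> (\<forall>u. insert u B \<in> R \<longrightarrow> u \<in> insert w X)"
          using s wX by auto
      qed (use s kP Pn in auto)
      then have "length (w # P) \<le> length P" using maxP unfolding S_def by blast
      then show False by simp
    qed
    \<comment> \<open>A remainder shorter than an edge is dropped, so that a nonempty path always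
      has an end of \<open>k - 1\<close> vertices inside an edge. Its vertices stay in
      \<open>X\<close>.\<close>
    define P' where "P' = (if k \<le> length (drop (k - 1) P) then drop (k - 1) P else [])"
    have P'sub: "set P' \<subseteq> set (drop (k - 1) P)" by (auto simp: P'_def)
    have disjPB: "B \<inter> set (drop (k - 1) P) = {}"
      using s by (auto simp: B_def set_take_disj_set_drop_if_distinct)
    have Bne: "B \<noteq> {}" using cardB k by auto
    have apart: "C \<inter> set P = {}" if "C \<in> BB" for C using s that by simp
    have BnotBB: "B \<notin> BB" using apart[of B] BP Bne by auto
    have "state (Suc m) P' X (insert B BB)"
      unfolding state_def
    proof (intro conjI)
      show "distinct P'" using s by (simp add: P'_def)
      show "set P' \<subseteq> X" using P'sub s by (auto dest: in_set_dropD)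
      show "card X \<le> length P' + 2 * k * Suc m" using s by (auto simp: P'_def)
      show "\<forall>i. i + k \<le> length P' \<longrightarrow> set (take k (drop i P')) \<in> R"
        using s by (auto simp: P'_def)
      show "P' = [] \<or> k \<le> length P'" by (auto simp: P'_def)
      show "length P' \<le> n" using s by (auto simp: P'_def)
      show "card (insert B BB) = Suc m" using s BnotBB by simp
      have "disjoint BB" using s by simp
      then show "disjoint (insert B BB)"
        using apart BP by (fastforce simp: disjoint_def)
      show "insert B BB \<subseteq> shadow k R" using s Bsh by auto
      have "C \<inter> set P' = {}" if "C \<in> BB" for C
        using apart[OF that] P'sub by (auto dest: in_set_dropD)
      then show "\<forall>C\<in>insert B BB. C \<inter> set P' = {} \<and> C \<subseteq> X \<and> (\<forall>w. insert w C \<in> R \<longrightarrow> w \<in> X)"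
        using s disjPB P'sub stuck BP by auto
    qed (use s in auto)
    then show ?case by blast
  qed
  then obtain P X BB where st: "state M P X BB" by blast
  from size[OF st] have "card X \<le> 3 * n" by simp
  then have "\<exists>B\<in>BB. \<exists>w. w \<notin> X \<and> insert w B \<in> R"
    using st by (intro dead) (auto simp: state_def)
  then show False using st by (auto simp: state_def)
qed

text \<open>Blocks are ordered by their minima, and a pair is classified by whether the block
  containing its centre comes later or earlier. Mutual containment inside one class would give a
  cycle in this order. Since a centre lies in at most one block, the two classes cover
  \<open>T\<close>, so one of them has at least half of it.\<close>

lemma oriented_subfamily:
  fixes BB :: "'a :: linorder set set"
  assumes disj: "disjoint BB" and BB: "\<And>B. B \<in> BB \<Longrightarrow> finite B \<and> B \<noteq> {}"
    and T: "finite T" "T \<subseteq> BB \<times> X" "\<And>B w. (B, w) \<in> T \<Longrightarrow> w \<notin> B"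
  obtains Q where "Q \<subseteq> T" "oriented Q" "card T \<le> 2 * card Q"
proof -
  define Q1 where "Q1 = {(B, w) \<in> T. \<forall>B'\<in>BB. w \<in> B' \<longrightarrow> Min B < Min B'}"
  define Q2 where "Q2 = {(B, w) \<in> T. \<forall>B'\<in>BB. w \<in> B' \<longrightarrow> Min B' < Min B}"
  have "oriented Q1" "oriented Q2"
  proof -
    have BB_T: "B \<in> BB" if "(B, w) \<in> T" for B w using that T(2) by auto
    show "oriented Q1" unfolding oriented_def Q1_def
      by clarify (meson BB_T less_asym)
    show "oriented Q2" unfolding oriented_def Q2_def
      by clarify (meson BB_T less_asym)
  qed
  moreover have "T \<subseteq> Q1 \<union> Q2"
  proof clarify
    fix B w assume A: "(B, w) \<in> T" "(B, w) \<notin> Q2"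
    then obtain B' where B': "B' \<in> BB" "w \<in> B'" "\<not> Min B' < Min B" by (auto simp: Q2_def)
    have B: "B \<in> BB" "w \<notin> B" using A T by auto
    have "Min B \<in> B" "Min B' \<in> B'" using BB B B' by auto
    moreover have "B \<inter> B' = {}" using disj B B' by (auto simp: disjoint_def)
    ultimately have "Min B \<noteq> Min B'" by auto
    then have "Min B < Min B'" using B'(3) by auto
    moreover have "B'' = B'" if "B'' \<in> BB" "w \<in> B''" for B''
      using disj that B' by (auto simp: disjoint_def)
    ultimately show "(B, w) \<in> Q1" using A by (auto simp: Q1_def)
  qed
  then have "card T \<le> card (Q1 \<union> Q2)"
    using T(1) by (intro card_mono) (auto simp: Q1_def Q2_def intro: finite_subset[OF _ T(1)])
  then have "card T \<le> card Q1 + card Q2" using card_Un_le order_trans by blast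
  then have "card T \<le> 2 * card Q1 \<or> card T \<le> 2 * card Q2" by linarith
  moreover have "Q1 \<subseteq> T" "Q2 \<subseteq> T" by (auto simp: Q1_def Q2_def)
  ultimately show ?thesis using that by blast
qed

lemma copy_of_tight_path_list:
  assumes "distinct P" "length P = n" "set P \<subseteq> V" "1 \<le> k"
    and "\<And>i. i + k \<le> n \<Longrightarrow> set (take k (drop i P)) \<in> R"
  shows "copy_of_in (\<lambda>i. P ! (i - 1)) (tight_path k n) (V, R)"
proof -
  \<comment> \<open>The vertices of \<open>tight_path\<close> are numbered from 1 and list positions
    from 0, hence the shift by one.\<close>
  have "(\<lambda>i. P ! (i - 1)) ` {i..i + k - 1} = set (take k (drop (i - 1) P))"
    if i: "1 \<le> i" "i + k - 1 \<le> n" for i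
  proof -
    have "{i..i + k - 1} = (\<lambda>j. i + j) ` {0..<k}"
      using image_add_atLeastLessThan[of i 0 k] assms(4) i by auto
    then have "(\<lambda>i. P ! (i - 1)) ` {i..i + k - 1} = (\<lambda>j. P ! (i + j - 1)) ` {0..<k}"
      by (simp only: image_image)
    also have "\<dots> = (\<lambda>j. P ! (i - 1 + j)) ` {0..<k}"
      using i by (intro image_cong) auto
    also have "\<dots> = (!) (take k (drop (i - 1) P)) ` {0..<length (take k (drop (i - 1) P))}"
      using assms i by (intro image_cong) auto
    also have "\<dots> = set (take k (drop (i - 1) P))"
      by (metis list.set_map map_nth set_upt)
    finally show ?thesis .
  qed
  then have edge: "(\<lambda>i. P ! (i - 1)) ` e \<in> R" if "e \<in> hedges (tight_path k n)" for e
    using that assms(4) by (auto simp: tight_path_def intro!: assms(5))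
  have "inj_on (\<lambda>i. P ! (i - 1)) {1..n}"
    using assms by (auto simp: inj_on_def nth_eq_iff_index_eq)
  moreover have "(\<lambda>i. P ! (i - 1)) ` {1..n} \<subseteq> V"
    using assms by (force intro: nth_mem)
  ultimately show ?thesis using edge by (simp add: copy_of_in_def tight_path_def)
qed

text \<open>The deterministic half of the argument. \<open>large\<close> ensures that the search can
  always restart, while \<open>s\<close> and \<open>none\<close> exclude \<open>M\<close>
  simultaneous dead ends.\<close>

lemma ramsey_arrow_cliques:
  fixes V :: "'a :: linorder set"
  assumes V: "finite V" and k: "2 \<le> k" "k \<le> n" and p: "0 < p"
    and reg: "nbr_regular k p V G"
    and large: "12 * real n * real k * 72 ^ k < real (card V)"
    and M: "k * M \<le> n"
    and s: "real s < real M * (real (card V) * p ^ (k - 1) / (32 * real k)) / 2 + 1"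
    and none: "\<And>BB X. disjoint BB \<Longrightarrow> card BB = M \<Longrightarrow> (\<And>B. B \<in> BB \<Longrightarrow> B \<subseteq> V \<and> card B = k - 1) \<Longrightarrow>
        X \<subseteq> V \<Longrightarrow> card X \<le> 3 * n \<Longrightarrow> overfull s G BB X = {}"
  shows "ramsey_arrow (V, cliques V G {} k) (tight_path k n)"
  unfolding ramsey_arrow_def
proof
  fix c :: "'a set \<Rightarrow> bool"
  define H where "H = cliques V G {} k"
  define x where "x = real (card V) * p ^ (k - 1)"
  \<comment> \<open>Each \<open>(k - 1)\<close>-clique extends in at least \<open>x / 8\<close> ways
    and each edge contains \<open>k\<close> of them, so this \<open>t\<close> makes the cleaning
    cost at most \<open>card H / 4\<close>. Of the majority colour, at least
    \<open>card H / 2\<close>, a quarter of \<open>H\<close> survives.\<close>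
  define t where "t = x / (32 * real k)"
  have finH: "finite H" unfolding H_def by (rule finite_cliques[OF V])
  have edge: "e \<subseteq> V" "card e = k" "finite e" "pairs e \<subseteq> G" if "e \<in> H" for e
    using that V finite_subset by (auto simp: H_def cliques_def)
  have "0 \<le> 12 * real n * real k * 72 ^ k" by simp
  then have "0 < real (card V)" using large by linarith
  then have Vne: "V \<noteq> {}" by auto
  then have N0: "0 < real (card V)" using V by (simp add: card_gt_0_iff)
  then have x0: "0 < x" using p by (simp add: x_def)
  have t0: "0 < t" using x0 k by (simp add: t_def)
  have H0: "0 < real (card H)" unfolding H_def using card_cliques_pos[OF V Vne reg p, of k] by simp
  obtain b R where R: "R \<subseteq> H" "card H \<le> 2 * card R" "\<And>e. e \<in> R \<Longrightarrow> c e = b"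
  proof -
    have "H = {e \<in> H. c e} \<union> {e \<in> H. \<not> c e}" by auto
    then have "card H \<le> card {e \<in> H. c e} + card {e \<in> H. \<not> c e}"
      by (metis card_Un_le)
    then consider "card H \<le> 2 * card {e \<in> H. c e}" | "card H \<le> 2 * card {e \<in> H. \<not> c e}"
      by linarith
    then show ?thesis
    proof cases
      case 1
      then show ?thesis by (intro that[of "{e \<in> H. c e}" True]) simp_all
    next
      case 2
      then show ?thesis by (intro that[of "{e \<in> H. \<not> c e}" False]) simp_all
    qed
  qed
  have finR: "finite R" using R(1) finH finite_subset by blast
  obtain R' where R': "R' \<subseteq> R" "real (card R) - t * real (card (shadow k R))
        \<le> real (card R') - t * real (card (shadow k R'))"
    and deg: "\<And>B. B \<in> shadow k R' \<Longrightarrow> t \<le> real (card {e \<in> R'. B \<subseteq> e})"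
    by (rule subhypergraph_large_codegree[OF finR, where k = k and t = t]) (use R edge in auto)
  have R'H: "R' \<subseteq> H" using R' R by auto
  have finR': "finite R'" using R'H finH finite_subset by blast
  have "shadow k R \<subseteq> cliques V G {} (k - 1)"
  proof
    fix B assume "B \<in> shadow k R"
    then obtain e where e: "e \<in> R" "B \<subseteq> e" "card B = k - 1" by (auto simp: shadow_def)
    have "pairs B \<subseteq> pairs e" using e by (auto simp: pairs_def)
    then show "B \<in> cliques V G {} (k - 1)" using e R edge[of e] by (auto simp: cliques_def)
  qed
  then have "card (shadow k R) \<le> card (cliques V G {} (k - 1))"
    by (intro card_mono finite_cliques V)
  then have "t * real (card (shadow k R)) \<le> t * real (card (cliques V G {} (k - 1)))"
    using t0 by (intro mult_left_mono) auto
  also have "\<dots> \<le> real (card H) / 4"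
  proof -
    have "real (card (cliques V G {} (k - 1))) * (x / 8) \<le> real k * real (card H)"
      using card_cliques_Suc_ge[OF V reg, of "k - 1"] k by (simp add: H_def x_def)
    then show ?thesis using k by (simp add: t_def field_simps)
  qed
  finally have "real (card H) / 4 \<le> real (card R')"
  proof -
    assume "t * real (card (shadow k R)) \<le> real (card H) / 4"
    moreover have "0 \<le> t * real (card (shadow k R'))" using t0 by simp
    moreover have "real (card H) \<le> 2 * real (card R)" using R(2) by linarith
    ultimately show ?thesis using R'(2) by linarith
  qed
  note R'large = this
  have avoid: "\<exists>e\<in>R'. e \<inter> X = {}" if X: "X \<subseteq> V" "card X \<le> 3 * n" for X
  proof (rule ccontr)
    assume "\<not> ?thesis"
    then have "R' \<subseteq> {e \<in> H. e \<inter> X \<noteq> {}}" using R'H by auto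
    then have "card R' \<le> card {e \<in> H. e \<inter> X \<noteq> {}}" using finH by (intro card_mono) auto
    then have "real (card V) * real (card R') \<le> real (card V) * real (card {e \<in> H. e \<inter> X \<noteq> {}})"
      by (intro mult_left_mono of_nat_mono) auto
    also have "\<dots> \<le> real (card X) * (real k * 72 ^ k * real (card H))"
      using card_cliques_meeting_le[OF V reg _ _ X(1)] p k by (simp add: H_def)
    also have "\<dots> \<le> (3 * real n) * (real k * 72 ^ k * real (card H))"
      using X(2) by (intro mult_right_mono) auto
    \<comment> \<open>The 12 combines \<open>card X \<le> 3 * n\<close> with the surviving quarter
      of \<open>H\<close>.\<close>
    also have "\<dots> = (12 * real n * real k * 72 ^ k) * (real (card H) / 4)" by simp
    also have "\<dots> < real (card V) * (real (card H) / 4)"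
      using large H0 by (intro mult_strict_right_mono) auto
    also have "\<dots> \<le> real (card V) * real (card R')"
      using R'large by (intro mult_left_mono) auto
    finally show False by simp
  qed
  have dead: "\<exists>B\<in>BB. \<exists>w. w \<notin> X \<and> insert w B \<in> R'"
    if disj: "disjoint BB" and cBB: "card BB = M" and sh: "BB \<subseteq> shadow k R'"
      and X: "X \<subseteq> V" "card X \<le> 3 * n" for BB X
  proof (rule ccontr)
    assume "\<not> ?thesis"
    then have inX: "w \<in> X" if "B \<in> BB" "insert w B \<in> R'" for B w using that by blast
    have B: "B \<subseteq> V" "card B = k - 1" "finite B" "B \<noteq> {}" if BBB: "B \<in> BB" for B
    proof -
      obtain e where "e \<in> R'" "B \<subseteq> e" and cB: "card B = k - 1"
        using BBB sh by (auto simp: shadow_def)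
      then show "B \<subseteq> V" using R'H edge[of e] by auto
      then show "finite B" using V finite_subset by auto
      show "card B = k - 1" "B \<noteq> {}" using cB k by auto
    qed
    have finX: "finite X" using X V finite_subset by auto
    have finBB: "finite BB" using sh finite_shadow[OF finR'] R'H edge(3) finite_subset by blast
    \<comment> \<open>If no dead end extends outside \<open>X\<close>, each has at least
      \<open>t\<close> extensions inside it. Edges of \<open>R'\<close> are cliques, so every such
      extension is a star of \<open>G\<close>.\<close>
    define W where "W B = {w \<in> X. w \<notin> B \<and> insert w B \<in> R'}" for B
    define T where "T = (SIGMA B:BB. W B)"
    have Wdeg: "t \<le> real (card (W B))" if BBB: "B \<in> BB" for B
    proof -
      have "{e \<in> R'. B \<subseteq> e} \<subseteq> (\<lambda>w. insert w B) ` W B"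
      proof
        fix e assume e: "e \<in> {e \<in> R'. B \<subseteq> e}"
        then have fe: "finite e" "card e = k" using R'H edge by auto
        then have "card (e - B) = 1" using e B[OF BBB] k by (simp add: card_Diff_subset)
        then obtain w where w: "e - B = {w}" by (auto simp: card_1_singleton_iff)
        then have "e = insert w B" "w \<notin> B" using e by auto
        then show "e \<in> (\<lambda>w. insert w B) ` W B" using e inX[OF BBB, of w] by (auto simp: W_def)
      qed
      then have "card {e \<in> R'. B \<subseteq> e} \<le> card (W B)"
        using finX by (intro surj_card_le) (auto simp: W_def)
      then show ?thesis using deg[of B] sh BBB by fastforce
    qed
    have finT: "finite T" unfolding T_def using finBB finX by (auto simp: W_def)
    have TX: "T \<subseteq> BB \<times> X" by (auto simp: T_def W_def)
    have "real M * t = (\<Sum>B\<in>BB. t)" using cBB by simp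
    also have "\<dots> \<le> (\<Sum>B\<in>BB. real (card (W B)))" by (intro sum_mono Wdeg)
    also have "\<dots> = real (card T)" unfolding T_def using finBB finX
      by (subst card_SigmaI) (auto simp: W_def)
    finally have cT: "real M * t \<le> real (card T)" .
    obtain Q where Q: "Q \<subseteq> T" "oriented Q" "card T \<le> 2 * card Q"
      by (rule oriented_subfamily[OF disj _ finT TX]) (use B in \<open>auto simp: T_def W_def\<close>)
    \<comment> \<open>\<open>Q\<close> keeps half of at least \<open>M * t\<close> stars; the extra
      1 absorbs the rounding up in the choice of \<open>s\<close>.\<close>
    have "real s < real (card Q) + 1"
      using s cT Q(3) by (simp add: t_def x_def)
    then have "s \<le> card Q" by linarith
    then obtain Q' where Q': "Q' \<subseteq> Q" "card Q' = s" by (meson obtain_subset_with_card_n)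
    have "oriented Q'" using Q(2) Q'(1) unfolding oriented_def by blast
    moreover have "star_edges Q' \<subseteq> G"
    proof
      fix f assume "f \<in> star_edges Q'"
      then obtain B w a where a: "(B, w) \<in> Q'" "a \<in> B" "f = {a, w}" by (auto simp: star_edges_def)
      then have "(B, w) \<in> T" using Q Q' by auto
      then have w: "insert w B \<in> R'" "w \<notin> B" by (auto simp: T_def W_def)
      then have "f \<in> pairs (insert w B)" using a by (auto simp: pairs_insert)
      then show "f \<in> G" using edge(4) w R'H by blast
    qed
    ultimately have "Q' \<in> overfull s G BB X" using Q Q' TX by (auto simp: overfull_def)
    moreover have "overfull s G BB X = {}" using B disj cBB X by (intro none) auto
    ultimately show False by simp
  qed
  obtain P where P: "distinct P" "length P = n" "set P \<subseteq> V"
      "\<And>i. i + k \<le> n \<Longrightarrow> set (take k (drop i P)) \<in> R'"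
    using tight_path_by_search[OF k V _ avoid dead M] R'H edge by blast
  have copy: "copy_of_in (\<lambda>i. P ! (i - 1)) (tight_path k n) (V, R')"
    by (rule copy_of_tight_path_list[OF P(1-3) _ P(4)]) (use k in auto)
  then have "copy_of_in (\<lambda>i. P ! (i - 1)) (tight_path k n) (V, cliques V G {} k)"
    using R'H by (auto simp: copy_of_in_def H_def)
  moreover have "c ((\<lambda>i. P ! (i - 1)) ` e) = b" if "e \<in> hedges (tight_path k n)" for e
    using copy that R(3) R'(1) by (auto simp: copy_of_in_def)
  ultimately show "\<exists>f b. copy_of_in f (tight_path k n) (V, cliques V G {} k)
      \<and> (\<forall>e\<in>hedges (tight_path k n). c (f ` e) = b)" by blast
qed

section \<open>Existence of the random graph\<close>

lemma choose_le_power: "(m choose s) \<le> m ^ s"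
proof -
  have "(m choose s) * 1 \<le> (m choose s) * fact s" by (intro mult_left_mono) (simp_all add: Suc_le_eq)
  then show ?thesis using binomial_fact_pow[of m s] by linarith
qed

lemma card_small_subsets_le:
  assumes V: "finite V" and N: "2 \<le> card V"
  shows "card {S. S \<subseteq> V \<and> card S < k} \<le> card V ^ k"
proof (induction k)
  case 0
  then show ?case by simp
next
  case (Suc k)
  have "{S. S \<subseteq> V \<and> card S < Suc k} = {S. S \<subseteq> V \<and> card S < k} \<union> {S. S \<subseteq> V \<and> card S = k}"
    by auto
  then have "card {S. S \<subseteq> V \<and> card S < Suc k}
      \<le> card {S. S \<subseteq> V \<and> card S < k} + card {S. S \<subseteq> V \<and> card S = k}"
    by (simp add: card_Un_le)
  also have "\<dots> \<le> card V ^ k + card V ^ k"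
    using Suc choose_le_power[of "card V" k] by (simp add: n_subsets[OF V])
  also have "\<dots> \<le> card V ^ Suc k" using mult_le_mono1[OF N, of "card V ^ k"] unfolding power_Suc by linarith
  finally show ?case .
qed

text \<open>The power is at most \<open>exp (- (N * q / 4))\<close>, as at least half of
  \<open>N\<close> remains in the exponent, and the weight costs only
  \<open>exp (N * q / 8)\<close>.\<close>

lemma half_power_tail:
  fixes q x :: real
  assumes q: "0 \<le> q" "q \<le> 1" and j: "2 * j \<le> N"
  shows "2 powr (real N * q / 8) * (1 - q / 2) ^ (N - j) \<le> exp (- (real N * q / 8))"
proof -
  have "(1 - q / 2) ^ (N - j) \<le> exp (- (q / 2)) ^ (N - j)"
    using exp_ge_add_one_self[of "- (q / 2)"] q by (intro power_mono) auto
  also have "\<dots> = exp (- (q / 2) * real (N - j))" by (simp add: exp_of_nat_mult[symmetric] mult.commute)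
  also have "\<dots> \<le> exp (- (real N * q / 4))"
  proof -
    have "real N / 2 \<le> real (N - j)" using j by (simp add: of_nat_diff)
    then have "q * (real N / 2) \<le> q * real (N - j)" using q by (intro mult_left_mono) auto
    then show ?thesis by simp
  qed
  finally have a: "(1 - q / 2) ^ (N - j) \<le> exp (- (real N * q / 4))" .
  have "2 powr (real N * q / 8) = exp ((real N * q / 8) * ln 2)" by (simp add: powr_def)
  also have "\<dots> \<le> exp (real N * q / 8)" using q ln_2_less_1 by (simp add: mult_left_le)
  finally have "2 powr (real N * q / 8) * (1 - q / 2) ^ (N - j)
      \<le> exp (real N * q / 8) * exp (- (real N * q / 4))"
    using a q by (intro mult_mono) auto
  then show ?thesis by (simp add: mult.commute flip: exp_add)
qed

lemma exp_two_le: "exp (2::real) \<le> 9"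
proof -
  have "exp (1::real) ^ 2 \<le> 3 ^ 2" using exp_le by (intro power_mono) auto
  then show ?thesis by (simp flip: exp_of_nat_mult)
qed

text \<open>Three nonnegative quantities measure too few common neighbours (\<open>f1\<close>), too
  many (\<open>f2\<close>) and overfull families of dead ends (\<open>f3\<close>). Each has mean at
  most 1/4, so some graph makes their sum less than 1. The counts in \<open>f2\<close> and
  \<open>f3\<close> are then zero, and every summand of \<open>f1\<close> is below 1.\<close>

lemma random_graph_exists:
  fixes V :: "'a set"
  defines "N \<equiv> card V"
  assumes V: "finite V" and k: "1 \<le> k" and p: "0 < p" "p \<le> 1"
    and N: "2 * k \<le> N" and M: "1 \<le> M"
    and dense: "64 * real k * (real k + 2) * ln (real N) \<le> real N * p ^ (k - 1)"
    and large: "1728 * real k * real n \<le> real N"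
    and entropy: "real N \<le> real M * ln (real N)"
  defines "s \<equiv> nat \<lceil>real M * (real N * p ^ (k - 1) / (32 * real k)) / 2\<rceil>"
  obtains G where "nbr_regular k p V G"
    "\<And>BB X. disjoint BB \<Longrightarrow> card BB = M \<Longrightarrow> (\<And>B. B \<in> BB \<Longrightarrow> B \<subseteq> V \<and> card B = k - 1) \<Longrightarrow>
        X \<subseteq> V \<Longrightarrow> card X \<le> 3 * n \<Longrightarrow> overfull s G BB X = {}"
proof -
  define L where "L = ln (real N)"
  have N2: "2 \<le> N" using N k by simp
  have L0: "0 < L" using N2 by (simp add: L_def)
  have expL: "exp (- (real m * L)) = 1 / real N ^ m" for m
    using N2 by (simp add: L_def exp_minus exp_of_nat_mult inverse_eq_divide)
  have quarter: "1 / real N ^ 2 \<le> 1 / 4"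
    using power_mono[of 2 "real N" 2] N2 by (intro divide_left_mono) auto
  define I where "I = {S. S \<subseteq> V \<and> card S < k}"
  define x where "x S = real N * p ^ card S" for S :: "'a set"
  define r where "r S = nat \<lceil>9 * x S\<rceil>" for S :: "'a set"
  define F where "F = {BB. BB \<subseteq> {B. B \<subseteq> V \<and> card B = k - 1} \<and> card BB = M \<and> disjoint BB}"
  define J where "J = {X. X \<subseteq> V \<and> card X \<le> 3 * n}"
  define f1 where "f1 G = (\<Sum>S\<in>I. 2 powr (x S / 8) * (1/2) ^ card (common_nbrs V G S))" for G
  define f2 where "f2 G = (\<Sum>S\<in>I. real (card (overfull (r S) G {S} V)))" for G
  define f3 where "f3 G = (\<Sum>(BB, X)\<in>F \<times> J. real (card (overfull s G BB X)))" for G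
  have finI: "finite I" "finite J" unfolding I_def J_def
    by (rule finite_subset[of _ "Pow V"]; use V in auto)+
  have finBs: "finite {B. B \<subseteq> V \<and> card B = k - 1}"
    by (rule finite_subset[of _ "Pow V"]) (use V in auto)
  have finF: "finite F" unfolding F_def
    by (rule finite_subset[of _ "Pow {B. B \<subseteq> V \<and> card B = k - 1}"]) (use finBs in auto)
  have cI: "real (card I) \<le> real N ^ k"
    using card_small_subsets_le[OF V, of k] N2 unfolding I_def N_def
    by (metis of_nat_mono of_nat_power)
  have xlarge: "64 * real k * (real k + 2) * L \<le> x S" if "S \<in> I" for S
  proof -
    have "p ^ (k - 1) \<le> p ^ card S" using that p by (intro power_decreasing) (auto simp: I_def)
    then have "real N * p ^ (k - 1) \<le> x S" unfolding x_def by (intro mult_left_mono) auto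
    then show ?thesis using dense by (simp add: L_def)
  qed
  have x8: "real (k + 2) * L \<le> x S / 8" if "S \<in> I" for S
  proof -
    have "8 * (real (k + 2) * L) \<le> 64 * real k * (real (k + 2) * L)"
      using k L0 by (intro mult_right_mono) auto
    then show ?thesis using xlarge[OF that] by (simp add: algebra_simps)
  qed
  have xpos: "0 < x S" for S using p N2 by (simp add: x_def)
  \<comment> \<open>The \<open>k + 2\<close> in the density condition pays \<open>N ^ k\<close> for
    the choice of \<open>S\<close> and leaves \<open>1 / N ^ 2\<close>.\<close>
  have small: "(\<Sum>S\<in>I. g S) \<le> 1 / 4" if "\<And>S. S \<in> I \<Longrightarrow> g S \<le> exp (- (real (k + 2) * L))" for g
  proof -
    have "(\<Sum>S\<in>I. g S) \<le> real (card I) * (1 / real N ^ (k + 2))"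
      using sum_bounded_above[of I g "exp (- (real (k + 2) * L))"] that expL[of "k + 2"] by simp
    also have "\<dots> \<le> real N ^ k * (1 / real N ^ (k + 2))"
      by (intro mult_right_mono cI) auto
    also have "\<dots> = 1 / real N ^ 2" using N2 by (simp add: power_add power2_eq_square)
    finally show ?thesis using quarter by linarith
  qed
  have m1: "subset_mean p (pairs V) f1 \<le> 1 / 4"
    unfolding f1_def subset_mean_sum subset_mean_cmult
  proof (rule small)
    fix S assume S: "S \<in> I"
    then have SV: "S \<subseteq> V" "card S < k" by (auto simp: I_def)
    have "card (V - S) = N - card S"
      using finite_subset[OF SV(1) V] SV by (simp add: N_def card_Diff_subset)
    then have "2 powr (x S / 8) * subset_mean p (pairs V) (\<lambda>G. (1/2) ^ card (common_nbrs V G S))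
        = 2 powr (real N * p ^ card S / 8) * (1 - p ^ card S / 2) ^ (N - card S)"
      by (simp add: subset_mean_half_power_nbrs[OF V SV(1)] x_def)
    also have "\<dots> \<le> exp (- (x S / 8))" unfolding x_def
      using p N SV by (intro half_power_tail) (auto simp: power_le_one)
    also have "\<dots> \<le> exp (- (real (k + 2) * L))" using x8[OF S] by simp
    finally show "2 powr (x S / 8) * subset_mean p (pairs V) (\<lambda>G. (1/2) ^ card (common_nbrs V G S))
        \<le> exp (- (real (k + 2) * L))" .
  qed
  have m2: "subset_mean p (pairs V) f2 \<le> 1 / 4"
    unfolding f2_def subset_mean_sum
  proof (rule small)
    fix S assume S: "S \<in> I"
    have r: "9 * x S \<le> real (r S)" "0 < r S" using xpos[of S] by (auto simp: r_def real_nat_ceiling_ge)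
    have "subset_mean p (pairs V) (\<lambda>G. real (card (overfull (r S) G {S} V)))
        \<le> (exp 1 * real (card {S}) * real (card V) * p ^ card S / real (r S)) ^ r S"
      by (rule subset_mean_overfull[OF V]) (use S p r in \<open>auto simp: I_def\<close>)
    also have "\<dots> \<le> exp (-1) ^ r S"
    proof (rule power_mono)
      \<comment> \<open>With \<open>r S\<close> at least \<open>exp 2\<close> times
        \<open>x S\<close>, the base in the union bound is at most \<open>exp (-1)\<close>.\<close>
      have "exp 1 * x S * exp 1 \<le> 9 * x S"
        using exp_two_le xpos[of S] by (simp add: mult_ac flip: exp_add)
      then have "exp 1 * x S * exp 1 \<le> real (r S)" using r by linarith
      then have "exp 1 * x S \<le> exp (-1) * real (r S)" by (simp add: exp_minus field_simps)
      then show "exp 1 * real (card {S}) * real (card V) * p ^ card S / real (r S) \<le> exp (-1)"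
        using r by (simp add: x_def N_def divide_le_eq mult_ac)
    qed (use p in simp)
    also have "\<dots> = exp (- real (r S))" by (simp flip: exp_of_nat_mult)
    also have "\<dots> \<le> exp (- (real (k + 2) * L))" using x8[OF S] r xpos[of S] by simp
    finally show "subset_mean p (pairs V) (\<lambda>G. real (card (overfull (r S) G {S} V)))
        \<le> exp (- (real (k + 2) * L))" .
  qed
  define y where "y = real N * p ^ (k - 1)"
  have y0: "0 < y" using p N2 by (simp add: y_def)
  have sge: "real M * y / (64 * real k) \<le> real s"
    unfolding s_def y_def by (rule order_trans[OF _ real_nat_ceiling_ge]) simp
  have "0 < real M * y / (64 * real k)" using y0 M k by simp
  then have s0: "0 < s" using sge by linarith
  have sL: "real M * (real (k + 2) * L) \<le> real s"
  proof -
    have "real (k + 2) * L \<le> y / (64 * real k)"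
      using dense k by (simp add: y_def L_def field_simps)
    then have "real M * (real (k + 2) * L) \<le> real M * (y / (64 * real k))"
      by (intro mult_left_mono) auto
    then show ?thesis using sge by simp
  qed
  \<comment> \<open>There are at most \<open>exp ((k - 1) * M * L)\<close> choices of
    \<open>BB\<close> and, by \<open>entropy\<close>, at most \<open>exp (M * L)\<close> of
    \<open>X\<close>. Each pair contributes at most \<open>exp (- s)\<close>, where \<open>s\<close>
    is at least \<open>M * (k + 2) * L\<close>.\<close>
  have m3: "subset_mean p (pairs V) f3 \<le> 1 / 4"
  proof -
    have cF: "real (card F) \<le> exp (real (M * (k - 1)) * L)"
    proof -
      have "card F \<le> card {BB. BB \<subseteq> {B. B \<subseteq> V \<and> card B = k - 1} \<and> card BB = M}"
        by (rule card_mono)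
          (use finBs in \<open>auto simp: F_def intro: finite_subset[of _ "Pow {B. B \<subseteq> V \<and> card B = k - 1}"]\<close>)
      also have "\<dots> = (N choose (k - 1)) choose M"
        unfolding N_def n_subsets[OF finBs] n_subsets[OF V] ..
      also have "\<dots> \<le> (N choose (k - 1)) ^ M" by (rule choose_le_power)
      also have "\<dots> \<le> (N ^ (k - 1)) ^ M" by (intro power_mono choose_le_power) simp
      finally have "real (card F) \<le> real N ^ (M * (k - 1))"
        by (metis of_nat_mono of_nat_power power_mult mult.commute)
      also have "\<dots> = exp (real (M * (k - 1)) * L)"
        using N2 unfolding L_def by (subst exp_of_nat_mult) simp
      finally show ?thesis .
    qed
    have cJ: "real (card J) \<le> exp (real M * L)"
    proof -
      have "card J \<le> card (Pow V)" using V by (intro card_mono) (auto simp: J_def)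
      then have "real (card J) \<le> 2 ^ N"
        using V by (simp add: card_Pow N_def)
      also have "\<dots> \<le> exp 1 ^ N" using exp_ge_add_one_self[of 1] by (intro power_mono) auto
      also have "\<dots> = exp (real N)" by (simp flip: exp_of_nat_mult)
      also have "\<dots> \<le> exp (real M * L)" using entropy by (simp add: L_def)
      finally show ?thesis .
    qed
    have "subset_mean p (pairs V) f3
        = (\<Sum>(BB, X)\<in>F \<times> J. subset_mean p (pairs V) (\<lambda>G. real (card (overfull s G BB X))))"
      unfolding f3_def by (simp add: subset_mean_sum case_prod_unfold)
    also have "\<dots> \<le> (\<Sum>(BB, X)\<in>F \<times> J. exp (- (real M * (real (k + 2) * L))))"
    proof (rule sum_mono, clarify)
      fix BB X assume BB: "BB \<in> F" and X: "X \<in> J"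
      have fBB: "finite BB" using BB finBs finite_subset by (auto simp: F_def)
      have "subset_mean p (pairs V) (\<lambda>G. real (card (overfull s G BB X)))
          \<le> (exp 1 * real (card BB) * real (card X) * p ^ (k - 1) / real s) ^ s"
        by (rule subset_mean_overfull[OF V]) (use BB X p s0 fBB in \<open>auto simp: F_def J_def\<close>)
      also have "\<dots> \<le> exp (-1) ^ s"
      proof (rule power_mono)
        \<comment> \<open>\<open>1728 = 9 * 3 * 64\<close>: 9 bounds \<open>exp 2\<close>, 3 comes
          from \<open>card X \<le> 3 * n\<close>, and 64 from the lower bound on
          \<open>s\<close>.\<close>
        have "exp 1 * exp 1 * (192 * real k * real n) \<le> 9 * (192 * real k * real n)"
          using exp_two_le by (intro mult_right_mono) (auto simp flip: exp_add)
        then have "exp 1 * exp 1 * (192 * real k * real n) \<le> real N" using large by linarith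
        then have n3: "exp 1 * (exp 1 * (3 * real n)) \<le> real N / (64 * real k)"
          using k by (simp add: field_simps)
        have "real (card X) \<le> 3 * real n" using X by (simp add: J_def)
        then have "exp 1 * (exp 1 * real (card X)) \<le> exp 1 * (exp 1 * (3 * real n))"
          by (intro mult_left_mono) auto
        then have "exp 1 * (exp 1 * real (card X)) \<le> real N / (64 * real k)" using n3 by linarith
        then have "(exp 1 * (exp 1 * real (card X))) * (real M * p ^ (k - 1))
            \<le> real N / (64 * real k) * (real M * p ^ (k - 1))"
          using p by (intro mult_right_mono) auto
        also have "\<dots> \<le> real s" using sge by (simp add: y_def mult_ac)
        finally have "exp 1 * (exp 1 * real M * real (card X) * p ^ (k - 1)) \<le> real s"
          by (simp add: mult_ac)
        then have "exp 1 * real M * real (card X) * p ^ (k - 1) \<le> exp (-1) * real s"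
          by (simp add: exp_minus field_simps)
        then show "exp 1 * real (card BB) * real (card X) * p ^ (k - 1) / real s \<le> exp (-1)"
          using BB s0 by (simp add: F_def divide_le_eq)
      qed (use p in simp)
      also have "\<dots> = exp (- real s)" by (simp flip: exp_of_nat_mult)
      also have "\<dots> \<le> exp (- (real M * (real (k + 2) * L)))" using sL by simp
      finally show "subset_mean p (pairs V) (\<lambda>G. real (card (overfull s G BB X)))
        \<le> exp (- (real M * (real (k + 2) * L)))" .
    qed
    also have "\<dots> = real (card F) * real (card J) * exp (- (real M * (real (k + 2) * L)))"
      by (simp add: card_cartesian_product)
    also have "\<dots> \<le> exp (real (M * (k - 1)) * L) * exp (real M * L) * exp (- (real M * (real (k + 2) * L)))"
      by (intro mult_right_mono mult_mono cF cJ) auto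
    also have "\<dots> = exp (- (real (2 * M) * L))"
      using k by (simp add: of_nat_diff algebra_simps flip: exp_add)
    also have "\<dots> \<le> exp (- (real 2 * L))" using M L0 by simp
    finally show ?thesis using quarter expL[of 2] by simp
  qed
  have "subset_mean p (pairs V) (\<lambda>G. f1 G + f2 G + f3 G) < 1"
    unfolding subset_mean_add using m1 m2 m3 by linarith
  then obtain G where sum1: "f1 G + f2 G + f3 G < 1"
    using subset_mean_less_one[OF finite_pairs[OF V], of p "\<lambda>G. f1 G + f2 G + f3 G"] p by auto
  have nn: "0 \<le> f1 G" "0 \<le> f2 G" "0 \<le> f3 G"
    unfolding f1_def f2_def f3_def by (auto intro!: sum_nonneg)
  have fin_over: "finite (overfull s' G BB X)" if "finite BB" "finite X" for s' BB X
    unfolding overfull_def by (rule finite_subset[of _ "Pow (BB \<times> X)"]) (use that in auto)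
  have "nbr_regular k p V G"
    unfolding nbr_regular_def
  proof (intro allI impI)
    fix S assume "S \<subseteq> V" "card S < k"
    then have S: "S \<in> I" by (simp add: I_def)
    define d where "d = card (common_nbrs V G S)"
    have "2 powr (x S / 8) * (1/2) ^ d \<le> f1 G" unfolding f1_def d_def
      by (rule member_le_sum[OF S]) (use finI in auto)
    then have lt: "2 powr (x S / 8) * (1/2) ^ d < 1" using sum1 nn by linarith
    have "2 powr (x S / 8) * (1/2::real) ^ d = 2 powr (x S / 8 - real d)"
      by (simp add: powr_diff powr_realpow power_one_over)
    with lt have "2 powr (x S / 8 - real d) < 2 powr 0" by simp
    then have lower: "x S / 8 < real d" by (subst (asm) powr_less_cancel_iff) auto
    have "real (card (overfull (r S) G {S} V)) \<le> f2 G" unfolding f2_def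
      by (rule member_le_sum[OF S]) (use finI in auto)
    then have "card (overfull (r S) G {S} V) = 0" using sum1 nn by linarith
    then have empty: "overfull (r S) G {S} V = {}" using fin_over[of "{S}" V] V by simp
    \<comment> \<open>Any \<open>r S\<close> common neighbours of \<open>S\<close> would form an
      overfull family with the single block \<open>S\<close>.\<close>
    have "d < r S"
    proof (rule ccontr)
      assume "\<not> d < r S"
      then obtain A where A: "A \<subseteq> common_nbrs V G S" "card A = r S"
        unfolding d_def by (meson not_less obtain_subset_with_card_n)
      then have AV: "A \<subseteq> V - S" by (auto simp: common_nbrs_def)
      have "{S} \<times> A \<in> overfull (r S) G {S} V"
        using A AV subset_common_nbrs_iff[OF AV, of G]
        by (auto simp: overfull_def oriented_def card_cartesian_product)
      then show False using empty by simp
    qed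
    then have "real d \<le> 9 * x S" unfolding r_def by linarith
    with lower show "real (card V) * p ^ card S / 8 \<le> real (card (common_nbrs V G S)) \<and>
        real (card (common_nbrs V G S)) \<le> 9 * real (card V) * p ^ card S"
      by (simp add: x_def d_def N_def)
  qed
  moreover have "overfull s G BB X = {}"
    if A: "disjoint BB" "card BB = M" "\<And>B. B \<in> BB \<Longrightarrow> B \<subseteq> V \<and> card B = k - 1"
      "X \<subseteq> V" "card X \<le> 3 * n" for BB X
  proof -
    have mem: "(BB, X) \<in> F \<times> J" using A by (auto simp: F_def J_def)
    have "real (card (overfull s G BB X)) \<le> f3 G" unfolding f3_def
      using member_le_sum[OF mem, of "\<lambda>(BB, X). real (card (overfull s G BB X))"] finF finI by auto
    then have "card (overfull s G BB X) = 0" using sum1 nn by linarith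
    moreover have "finite BB" using A(2) M card_ge_0_finite by force
    moreover have "finite X" using A V finite_subset by auto
    ultimately show ?thesis using fin_over by simp
  qed
  ultimately show ?thesis using that by blast
qed

section \<open>The size-Ramsey bound\<close>

text \<open>\<open>N\<close> is a constant multiple of \<open>n\<close> large enough for the search,
  and \<open>A\<close> is the density constant of \<open>random_graph_exists\<close>.
  \<open>sparse\<close> makes the edge probability at most 1; \<open>entropy\<close> makes the
  number of sets \<open>X\<close> affordable with \<open>M = n div k\<close>.\<close>

lemma size_ramsey_tight_path_le:
  fixes k n N :: nat and A :: real
  assumes k: "2 \<le> k" "k \<le> n"
    and N_def: "N = 16 * k * 72 ^ k * n" and A_def: "A = 64 * real k * (real k + 2)"
    and sparse: "A * ln (real N) \<le> real N" and entropy: "2 * real k * (16 * real k * 72 ^ k) \<le> ln (real N)"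
  shows "real (size_ramsey k (tight_path k n))
    \<le> 9 ^ k * real N ^ k * (A * ln (real N) / real N) powr (real k / 2)"
proof -
  define V where "V = {..<N}"
  have V: "finite V" "card V = N" by (auto simp: V_def)
  have n0: "0 < n" using k by simp
  have "2 * 1 * 1 * k \<le> 16 * 72 ^ k * n * k" using n0 by (intro mult_mono) auto
  then have N: "2 * k \<le> N" by (simp add: N_def mult_ac)
  have NR: "real N = 16 * real k * 72 ^ k * real n" by (simp add: N_def)
  define M where "M = n div k"
  have M: "1 \<le> M" "k * M \<le> n" using k by (auto simp: M_def div_greater_zero_iff Suc_le_eq)
  \<comment> \<open>Rounding down loses at most a factor of 2 because \<open>M\<close> is at least
    1.\<close>
  have "n < k * (M + 1)" using k dividend_less_times_div[of k n] by (simp add: M_def)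
  also have "\<dots> \<le> k * (2 * M)" using M by (intro mult_left_mono) auto
  finally have "real n \<le> 2 * real k * real M"
    using of_nat_mono[of n "k * (2 * M)", where ?'a = real] by simp
  then have "16 * real k * 72 ^ k * real n \<le> 16 * real k * 72 ^ k * (2 * real k * real M)"
    by (intro mult_left_mono) auto
  also have "\<dots> = real M * (2 * real k * (16 * real k * 72 ^ k))" by simp
  also have "\<dots> \<le> real M * ln (real N)" using entropy by (intro mult_left_mono) auto
  finally have entropy': "real N \<le> real M * ln (real N)" by (simp add: NR)
  define q where "q = A * ln (real N) / real N"
  have "0 < ln (real N)" using N k by simp
  \<comment> \<open>\<open>q\<close> will be \<open>p ^ (k - 1)\<close>, so that
    \<open>N * q\<close> is exactly the density demanded of the random graph.\<close>
  then have q: "0 < q" "q \<le> 1" using sparse N k by (auto simp: q_def A_def divide_le_eq)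
  define p where "p = q powr (1 / real (k - 1))"
  have p: "0 < p" "p \<le> 1" using q by (auto simp: p_def intro: powr_le1)
  have ppow: "p ^ m = q powr (real m / real (k - 1))" for m
    using q by (simp add: p_def powr_powr flip: powr_realpow)
  have pk: "real N * p ^ (k - 1) = A * ln (real N)"
    using ppow[of "k - 1"] q(1) k N powr_one[of q] by (simp add: q_def)
  have "2 dvd k * (k - 1)" by (cases k) auto
  then have "real (k choose 2) = real k * real (k - 1) / 2"
    unfolding choose_two by (subst real_of_nat_div) auto
  \<comment> \<open>This quotient is the exponent of \<open>q\<close> in the number of
    \<open>k\<close>-cliques.\<close>
  then have "real (k choose 2) / real (k - 1) = real k / 2" using k by simp
  then have pc: "p ^ (k choose 2) = q powr (real k / 2)"
    by (simp only: ppow)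
  have "(72::real) ^ 2 \<le> 72 ^ k" using k by (intro power_increasing) auto
  then have "1728 \<le> 16 * (72::real) ^ k" by simp
  then have "1728 * (real k * real n) \<le> 16 * 72 ^ k * (real k * real n)" by (intro mult_right_mono) auto
  then have large: "1728 * real k * real n \<le> real N" by (simp add: NR mult_ac)
  define s where "s = nat \<lceil>real M * (real N * p ^ (k - 1) / (32 * real k)) / 2\<rceil>"
  obtain G where G: "nbr_regular k p V G"
    "\<And>BB X. disjoint BB \<Longrightarrow> card BB = M \<Longrightarrow> (\<And>B. B \<in> BB \<Longrightarrow> B \<subseteq> V \<and> card B = k - 1) \<Longrightarrow>
        X \<subseteq> V \<Longrightarrow> card X \<le> 3 * n \<Longrightarrow> overfull s G BB X = {}"
    using random_graph_exists[of V k p M n] V k p N M(1) large entropy' pk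
    unfolding V(2) s_def A_def by (metis One_nat_def Suc_leD numeral_2_eq_2 order_refl)
  define H where "H = cliques V G {} k"
  have "ramsey_arrow (V, H) (tight_path k n)"
    unfolding H_def
  proof (rule ramsey_arrow_cliques[OF V(1) k p(1) G(1) _ M(2) _ G(2)])
    show "12 * real n * real k * 72 ^ k < real (card V)" using n0 k by (simp add: V NR)
    have "0 \<le> real M * (real N * p ^ (k - 1) / (32 * real k)) / 2" using p by simp
    then show "real s < real M * (real (card V) * p ^ (k - 1) / (32 * real k)) / 2 + 1"
      unfolding s_def V(2) by linarith
  qed
  moreover have "uniform_hypergraph k (V, H)"
    using V by (auto simp: uniform_hypergraph_def H_def cliques_def)
  moreover have "uniform_hypergraph k (tight_path k n)" using k by (intro uniform_tight_path) simp
  ultimately have "size_ramsey k (tight_path k n) \<le> card H"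
    using size_ramsey_le[of k "tight_path k n" "(V, H)"] by simp
  also have "real (card H) \<le> 9 ^ k * real N ^ k * p ^ (k choose 2)"
    using card_cliques_le[OF V(1) G(1), of k] p by (simp add: H_def V)
  finally show ?thesis by (simp add: pc q_def)
qed

theorem theorem3:
  fixes k :: nat and \<alpha> :: real
  assumes "k \<ge> 3"
    and "\<alpha> = (real k - 2) / (real ((k - 1) choose 2) + 1)"
  shows "(\<lambda>n. real (size_ramsey k (tight_path k n)))
           \<in> O(\<lambda>n. real n powr (real k - 1 - \<alpha>) * ln (real n) powr (1 + \<alpha>))"
proof -
  define A where "A = 64 * real k * (real k + 2)"
  define C :: nat where "C = 16 * k * 72 ^ k"
  define c where "c = 9 ^ k * real C ^ k * (2 * A) powr (real k / 2)"
  have k3: "3 \<le> k" by fact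
  have C0: "0 < C" using k3 by (simp add: C_def)
  have A1: "1 \<le> A" using mult_mono[of 1 "64 * real k" 1 "real k + 2"] k3 by (simp add: A_def)
  have \<alpha>: "0 \<le> \<alpha>" "1 + \<alpha> \<le> real k / 2"
  proof -
    \<comment> \<open>For \<open>k \<ge> 3\<close> the denominator of \<open>\<alpha>\<close> is at
      least 2, whence \<open>\<alpha> \<le> (k - 2) / 2\<close>.\<close>
    have "1 \<le> (k - 1) choose 2" using k3 zero_less_binomial[of 2 "k - 1"] by linarith
    then have D: "2 \<le> real ((k - 1) choose 2) + 1" by linarith
    then show "0 \<le> \<alpha>" using k3 assms(2) by simp
    have "(real k - 2) / (real ((k - 1) choose 2) + 1) \<le> (real k - 2) / 2"
      using D k3 by (intro divide_left_mono) auto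
    then show "1 + \<alpha> \<le> real k / 2" by (simp add: assms(2) field_simps)
  qed
  have limN: "filterlim (\<lambda>n. real (C * n)) at_top sequentially"
    using C0 by (intro filterlim_compose[OF filterlim_real_sequentially] mult_nat_left_at_top) simp
  have "\<forall>\<^sub>F x in at_top. ln x / x < 1 / A"
    using ln_x_over_x_tendsto_0 A1 by (intro order_tendstoD) auto
  then have "\<forall>\<^sub>F x in at_top. A * ln x \<le> x"
    using eventually_gt_at_top[of "0 :: real"]
  proof eventually_elim
    case (elim x)
    then show ?case using A1 by (simp add: field_simps)
  qed
  then have ev1: "\<forall>\<^sub>F n in sequentially. A * ln (real (C * n)) \<le> real (C * n)"
    using limN by (rule eventually_compose_filterlim)
  have ev2: "\<forall>\<^sub>F n in sequentially. 2 * real k * (16 * real k * 72 ^ k) \<le> ln (real (C * n))"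
    using filterlim_compose[OF ln_at_top limN] by (simp add: filterlim_at_top)
  have "\<forall>\<^sub>F n in sequentially. norm (real (size_ramsey k (tight_path k n)))
      \<le> c * norm (real n powr (real k - 1 - \<alpha>) * ln (real n) powr (1 + \<alpha>))"
    using ev1 ev2 eventually_ge_at_top[of k] eventually_ge_at_top[of C]
  proof eventually_elim
    case (elim n)
    define N where "N = C * n"
    define u where "u = ln (real n) / real n"
    have n: "3 \<le> n" "0 < real n" using elim k3 by auto
    have ln0: "0 < ln (real n)" using n by simp
    have u: "0 < u" "u \<le> 1" using n ln0 ln_le_minus_one[of "real n"] by (auto simp: u_def)
    have N0: "0 < real N" using C0 n by (simp add: N_def)
    have nN: "real n \<le> real N" using C0 unfolding N_def by (intro of_nat_mono) simp
    have lnN0: "0 \<le> ln (real N)" using nN n by simp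
    \<comment> \<open>Since \<open>n\<close> is eventually at least the constant \<open>C\<close>,
      \<open>N = C * n\<close> is at most \<open>n * n\<close>.\<close>
    have "ln (real N) \<le> ln (real n * real n)"
      using elim N0 n by (subst ln_le_cancel_iff) (auto simp: N_def intro!: mult_right_mono)
    then have lnN: "ln (real N) \<le> 2 * ln (real n)" using n by (simp add: ln_mult)
    have "A * ln (real N) / real N \<le> A * (2 * ln (real n)) / real n"
      using A1 lnN nN N0 n lnN0 by (intro frac_le mult_left_mono mult_nonneg_nonneg) auto
    then have "A * ln (real N) / real N \<le> 2 * A * u" by (simp add: u_def mult_ac)
    then have "(A * ln (real N) / real N) powr (real k / 2) \<le> (2 * A * u) powr (real k / 2)"
      using A1 lnN0 N0 by (intro powr_mono2) auto
    also have "\<dots> = (2 * A) powr (real k / 2) * u powr (real k / 2)"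
      using A1 u by (simp add: powr_mult)
    \<comment> \<open>As \<open>u \<le> 1\<close>, lowering the exponent from \<open>k / 2\<close>
      to \<open>1 + \<alpha>\<close> can only increase the power; here the stronger exponent is
      given up.\<close>
    also have "\<dots> \<le> (2 * A) powr (real k / 2) * u powr (1 + \<alpha>)"
      using \<alpha> u by (intro mult_left_mono powr_mono') auto
    finally have q: "(A * ln (real N) / real N) powr (real k / 2)
        \<le> (2 * A) powr (real k / 2) * u powr (1 + \<alpha>)" .
    have "real (size_ramsey k (tight_path k n))
        \<le> 9 ^ k * real N ^ k * (A * ln (real N) / real N) powr (real k / 2)"
      using elim k3 by (intro size_ramsey_tight_path_le) (auto simp: A_def N_def C_def)
    also have "\<dots> \<le> 9 ^ k * real N ^ k * ((2 * A) powr (real k / 2) * u powr (1 + \<alpha>))"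
      using q by (intro mult_left_mono) auto
    also have "\<dots> = c * (real n powr real k * u powr (1 + \<alpha>))"
      using n by (simp add: c_def N_def powr_realpow power_mult_distrib)
    also have "real n powr real k * u powr (1 + \<alpha>)
        = real n powr (real k - 1 - \<alpha>) * ln (real n) powr (1 + \<alpha>)"
    proof -
      have "real n powr real k = real n powr (real k - 1 - \<alpha>) * real n powr (1 + \<alpha>)"
        by (simp flip: powr_add)
      moreover have "u powr (1 + \<alpha>) = ln (real n) powr (1 + \<alpha>) / real n powr (1 + \<alpha>)"
        using n ln0 unfolding u_def by (simp add: powr_divide)
      ultimately show ?thesis using n by simp
    qed
    finally show ?case by simp
  qed
  then show ?thesis by (rule bigoI)
qed

end
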